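(* Let $n\ge1$ and $0\le\rho\le1$, and let $(X_1,Y_1),\dots,(X_n,Y_n)$ be mutually independent pairs of real-valued random variables such that $\operatorname{Corr}(L^2(X_i),L^2(Y_i))\le\rho$ for all $i$. Let $X=(X_1,\dots,X_n)$ and $Y=(Y_1,\dots,Y_n)$. If $f:\mathbb{R}^n\to\mathbb{R}$ is a (Borel measurable) function with $\mathbb{E}[f(X)^2]<\infty$ and $\mathbb{E}[f(Y)^2]<\infty$ and, for some $\varepsilon>0$, $$\operatorname{Corr}\big(L^2(f(X)),\,L^2(X_1)+\cdots+L^2(X_n)\big)\le\sqrt{1-\varepsilon}\quad\text{and}\quad \operatorname{Corr}\big(L^2(f(Y)),\,L^2(Y_1)+\cdots+L^2(Y_n)\big)\le\sqrt{1-\varepsilon},$$ then $$\operatorname{Corr}\big(L^2(f(X)),L^2(f(Y))\big)\le(1-\varepsilon)\rho+\varepsilon\rho^2.$$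
   Context: All random variables live on a common probability space. For a random variable or random vector $Z$, $L^2(Z)$ denotes the linear space of square-integrable $\sigma(Z)$-measurable random variables, i.e. of $\varphi(Z)$ with $\varphi$ Borel and $\mathbb{E}[\varphi(Z)^2]<\infty$. $L^2(X_1)+\cdots+L^2(X_n)$ is the sum of linear subspaces. For linear subspaces $A,B$ of $L^2$, $\operatorname{Corr}(A,B)=\sup\{\operatorname{Corr}(u,v):u\in A,\ v\in B\}$, where $\operatorname{Corr}(u,v)$ is the usual correlation coefficient, taken to be $0$ if $u$ or $v$ is almost surely constant. *)

theory Defs
  imports "HOL-Probability.Probability"
begin

definition covar :: "'a measure \<Rightarrow> ('a \<Rightarrow> real) \<Rightarrow> ('a \<Rightarrow> real) \<Rightarrow> real" where
  "covar M u v =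
    (\<integral>\<omega>. (u \<omega> - (\<integral>x. u x \<partial>M)) * (v \<omega> - (\<integral>x. v x \<partial>M)) \<partial>M)"

definition corr :: "'a measure \<Rightarrow> ('a \<Rightarrow> real) \<Rightarrow> ('a \<Rightarrow> real) \<Rightarrow> real" where
  "corr M u v =
    (if (\<exists>c. AE \<omega> in M. u \<omega> = c) \<or> (\<exists>c. AE \<omega> in M. v \<omega> = c) then 0
     else covar M u v / (sqrt (covar M u u) * sqrt (covar M v v)))"

text \<open>
  The square-integrable random variables \<open>\<phi>(Z)\<close>, for a random variable
  \<open>Z\<close> with values in the measurable space \<open>N\<close>. Elements are functions
  on the sample space, not classes modulo almost sure equality; \<^const>\<open>corr\<close>
  does not distinguish the two.
\<close>

definition L2 :: "'a measure \<Rightarrow> 'b measure \<Rightarrow> ('a \<Rightarrow> 'b) \<Rightarrow> ('a \<Rightarrow> real) set" where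
  "L2 M N Z =
    {(\<lambda>\<omega>. \<phi> (Z \<omega>)) | \<phi>. \<phi> \<in> borel_measurable N \<and> integrable M (\<lambda>\<omega>. (\<phi> (Z \<omega>))\<^sup>2)}"

definition space_sum :: "'i set \<Rightarrow> ('i \<Rightarrow> ('a \<Rightarrow> real) set) \<Rightarrow> ('a \<Rightarrow> real) set" where
  "space_sum I A = {(\<lambda>\<omega>. \<Sum>i\<in>I. u i \<omega>) | u. \<forall>i\<in>I. u i \<in> A i}"

text \<open>
  The supremum is the one of the conditionally complete order on \<^typ>\<open>real\<close>. On a
  probability space it is the true supremum for nonempty sets of square-integrable
  random variables, since then all values lie between \<open>-1\<close> and \<open>1\<close>.
\<close>

definition Corr :: "'a measure \<Rightarrow> ('a \<Rightarrow> real) set \<Rightarrow> ('a \<Rightarrow> real) set \<Rightarrow> real" where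
  "Corr M A B = Sup {corr M u v | u v. u \<in> A \<and> v \<in> B}"

end

theory Submission
  imports Defs
begin

text \<open>
  Write \<open>g(X) = u + w\<close> for a centred \<open>g(X)\<close>, where \<open>u\<close> is its orthogonal projection to the sums of
  functions of the single \<open>X\<^sub>i\<close>, and likewise \<open>h(Y) = v + z\<close>. Then \<open>E[u z] = E[w v] = 0\<close>,
  \<open>E[u v] \<le> \<rho> \<parallel>u\<parallel> \<parallel>v\<parallel>\<close> and, because \<open>w\<close> and \<open>z\<close> only involve interactions of order at
  least two, \<open>E[w z] \<le> \<rho>\<^sup>2 \<parallel>w\<parallel> \<parallel>z\<parallel>\<close>. The correlation hypotheses on \<open>f\<close> say that \<open>u\<close> and \<open>v\<close>
  carry at most the fraction \<open>1 - \<epsilon>\<close> of the squared norms, and Cauchy--Schwarz concludes.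

  The two bounds are proved together by adding one coordinate at a time. The new ingredient in each
  step is the product of two independent pairs: if \<open>g(X\<^sub>1, X\<^sub>2)\<close> and \<open>h(Y\<^sub>1, Y\<^sub>2)\<close> have vanishing
  marginals, one replaces \<open>X\<^sub>2\<close> by \<open>Y\<^sub>2\<close> and then \<open>X\<^sub>1\<close> by \<open>Y\<^sub>1\<close>, and each replacement gains
  a factor \<open>\<rho>\<close>.
\<close>

section \<open>Square-integrable functions\<close>

definition sqint :: "'a measure \<Rightarrow> ('a \<Rightarrow> real) \<Rightarrow> bool" where
  "sqint M u \<longleftrightarrow> u \<in> borel_measurable M \<and> integrable M (\<lambda>x. (u x)\<^sup>2)"

text \<open>The L^2 norm. It carries this meaning only under \<open>sqint\<close>: the integral of a
  nonintegrable square is 0 by convention.\<close>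

definition nrm :: "'a measure \<Rightarrow> ('a \<Rightarrow> real) \<Rightarrow> real" where
  "nrm M u = sqrt (\<integral>x. (u x)\<^sup>2 \<partial>M)"

lemma sqintD[measurable_dest]: "sqint M u \<Longrightarrow> u \<in> borel_measurable M"
  by (simp add: sqint_def)

lemma sqint_square: "sqint M u \<Longrightarrow> integrable M (\<lambda>x. (u x)\<^sup>2)"
  by (simp add: sqint_def)

lemma nrm_nonneg [simp]: "0 \<le> nrm M u"
  by (simp add: nrm_def)

lemma nrm_power2: "(nrm M u)\<^sup>2 = (\<integral>x. (u x)\<^sup>2 \<partial>M)"
  by (simp add: nrm_def)

lemma integrable_sqint_mult:
  assumes "sqint M u" "sqint M v"
  shows "integrable M (\<lambda>x. u x * v x)"
proof (rule Bochner_Integration.integrable_bound)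
  show "integrable M (\<lambda>x. (u x)\<^sup>2 + (v x)\<^sup>2)"
    using assms by (simp add: sqint_def)
  have [measurable]: "u \<in> borel_measurable M" "v \<in> borel_measurable M"
    using assms by (simp_all add: sqint_def)
  show "(\<lambda>x. u x * v x) \<in> borel_measurable M"
    by measurable
  have "\<bar>a * b\<bar> \<le> a\<^sup>2 + b\<^sup>2" for a b :: real
  proof -
    have "2 * \<bar>a * b\<bar> \<le> a\<^sup>2 + b\<^sup>2"
      using sum_squares_bound[of "\<bar>a\<bar>" "\<bar>b\<bar>"] by (simp add: abs_mult)
    then show ?thesis by linarith
  qed
  then show "AE x in M. norm (u x * v x) \<le> norm ((u x)\<^sup>2 + (v x)\<^sup>2)"
    by simp
qed

lemma sqint_add:
  assumes "sqint M u" "sqint M v"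
  shows "sqint M (\<lambda>x. u x + v x)"
  using assms integrable_sqint_mult[OF assms]
  by (auto simp: sqint_def power2_sum mult.assoc)

lemma sqint_cmult: "sqint M u \<Longrightarrow> sqint M (\<lambda>x. c * u x)"
  by (auto simp: sqint_def power_mult_distrib)

lemma sqint_diff:
  assumes "sqint M u" "sqint M v"
  shows "sqint M (\<lambda>x. u x - v x)"
  using sqint_add[OF assms(1) sqint_cmult[OF assms(2), of "-1"]] by simp

lemma sqint_sum:
  "(\<And>i. i \<in> I \<Longrightarrow> sqint M (u i)) \<Longrightarrow> sqint M (\<lambda>x. \<Sum>i\<in>I. u i x)"
proof (induction I rule: infinite_finite_induct)
  case (insert i I)
  then show ?case using sqint_add[of M "u i" "\<lambda>x. \<Sum>i\<in>I. u i x"] by simp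
qed (auto simp: sqint_def)

lemma (in finite_measure) sqint_const: "sqint M (\<lambda>_. c)"
  by (simp add: sqint_def)

lemma (in finite_measure) integrable_sqint: "sqint M u \<Longrightarrow> integrable M u"
  by (auto simp: sqint_def intro: square_integrable_imp_integrable)

lemma nrm_eq_0_iff: "sqint M u \<Longrightarrow> nrm M u = 0 \<longleftrightarrow> (AE x in M. u x = 0)"
  by (simp add: nrm_def sqint_def integral_nonneg_eq_0_iff_AE)

lemma integral_add_mult:
  "sqint M u \<Longrightarrow> sqint M v \<Longrightarrow> sqint M w \<Longrightarrow>
    (\<integral>x. (u x + v x) * w x \<partial>M) = (\<integral>x. u x * w x \<partial>M) + (\<integral>x. v x * w x \<partial>M)"
  "sqint M u \<Longrightarrow> sqint M v \<Longrightarrow> sqint M w \<Longrightarrow>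
    (\<integral>x. w x * (u x + v x) \<partial>M) = (\<integral>x. w x * u x \<partial>M) + (\<integral>x. w x * v x \<partial>M)"
  by (simp_all add: distrib_left distrib_right integrable_sqint_mult)

lemma integral_diff_mult:
  "sqint M u \<Longrightarrow> sqint M v \<Longrightarrow> sqint M w \<Longrightarrow>
    (\<integral>x. (u x - v x) * w x \<partial>M) = (\<integral>x. u x * w x \<partial>M) - (\<integral>x. v x * w x \<partial>M)"
  by (simp add: left_diff_distrib integrable_sqint_mult)

lemma nrm_add_power2:
  assumes "sqint M u" "sqint M v"
  shows "(nrm M (\<lambda>x. u x + v x))\<^sup>2 = (nrm M u)\<^sup>2 + 2 * (\<integral>x. u x * v x \<partial>M) + (nrm M v)\<^sup>2"
  using assms integrable_sqint_mult[OF assms]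
  by (simp add: nrm_power2 power2_sum sqint_def mult.assoc)

text \<open>Cauchy--Schwarz. With \<open>b\<close> the squared norm of \<open>v\<close> and
  \<open>c\<close> the inner product, the squared norm of \<open>b u - c v\<close> equals
  \<open>b (a b - c^2)\<close> and is nonnegative; the case of vanishing \<open>v\<close> is
  separate.\<close>

lemma integral_mult_le_nrm:
  assumes u: "sqint M u" and v: "sqint M v"
  shows "(\<integral>x. u x * v x \<partial>M) \<le> nrm M u * nrm M v"
proof (cases "nrm M v = 0")
  case True
  then have "AE x in M. u x * v x = 0"
    using nrm_eq_0_iff[OF v] by auto
  then have "(\<integral>x. u x * v x \<partial>M) = 0"
    by (simp add: integral_eq_zero_AE)
  with True show ?thesis by simp
next
  case False
  define a b c where "a = (nrm M u)\<^sup>2" and "b = (nrm M v)\<^sup>2" and "c = (\<integral>x. u x * v x \<partial>M)"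
  have "0 \<le> (nrm M (\<lambda>x. b * u x + (- c) * v x))\<^sup>2" by simp
  also have "\<dots> = b * (a * b - c\<^sup>2)"
    unfolding nrm_add_power2[OF sqint_cmult[OF u, of b] sqint_cmult[OF v, of "-c"]]
    by (simp add: nrm_power2 power_mult_distrib a_def b_def c_def mult.assoc mult.left_commute[of "u _"])
       (simp add: power2_eq_square algebra_simps)
  finally have "0 \<le> b * (a * b - c\<^sup>2)" .
  moreover have "b > 0" using False by (simp add: b_def)
  ultimately have "c\<^sup>2 \<le> (nrm M u * nrm M v)\<^sup>2"
    by (simp add: zero_le_mult_iff a_def b_def power_mult_distrib)
  then show ?thesis
    unfolding c_def by (rule power2_le_imp_le) simp
qed

lemma abs_integral_mult_le_nrm:
  assumes u: "sqint M u" and v: "sqint M v"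
  shows "\<bar>\<integral>x. u x * v x \<partial>M\<bar> \<le> nrm M u * nrm M v"
  using integral_mult_le_nrm[OF u v] integral_mult_le_nrm[OF sqint_cmult[OF u, of "-1"] v]
  by (simp add: nrm_def)

lemma (in prob_space) sqint_center: "sqint M u \<Longrightarrow> sqint M (\<lambda>x. u x - expectation u)"
  by (intro sqint_diff sqint_const)

text \<open>Centring lowers the squared norm by exactly the square of the mean.\<close>

lemma (in prob_space) nrm_center_le:
  assumes u: "sqint M u"
  shows "nrm M (\<lambda>x. u x - expectation u) \<le> nrm M u"
proof -
  have "(nrm M (\<lambda>x. u x - expectation u))\<^sup>2 = (nrm M u)\<^sup>2 - (expectation u)\<^sup>2"
    using variance_eq[of u] u integrable_sqint[OF u] by (simp add: nrm_power2 sqint_def)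
  then have "(nrm M (\<lambda>x. u x - expectation u))\<^sup>2 \<le> (nrm M u)\<^sup>2"
    by simp
  then show ?thesis
    by (rule power2_le_imp_le) simp
qed

lemma sqint_distr_iff:
  assumes "X \<in> measurable M N" "u \<in> borel_measurable N"
  shows "sqint (distr M N X) u \<longleftrightarrow> sqint M (\<lambda>x. u (X x))"
  using assms by (auto simp: sqint_def integrable_distr_eq)

lemma nrm_distr:
  assumes "X \<in> measurable M N" "u \<in> borel_measurable N"
  shows "nrm (distr M N X) u = nrm M (\<lambda>x. u (X x))"
  using assms by (simp add: nrm_def integral_distr)

section \<open>Sections and marginals on a product of two probability spaces\<close>

context pair_prob_space
begin

lemma sqint_fst:
  assumes "sqint M1 u"
  shows "sqint (M1 \<Otimes>\<^sub>M M2) (\<lambda>w. u (fst w))"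
  using assms sqint_distr_iff[of fst "M1 \<Otimes>\<^sub>M M2" M1 u] M2.distr_pair_fst[of M1]
  by (simp add: sqintD)

text \<open>The inner integral is bounded on almost every fibre; Cauchy--Schwarz in the outer
  variable then recombines the fibre norms. Almost all fibres are square-integrable, so the bound
  may presuppose this.\<close>

lemma fibrewise_bound:
  assumes u: "sqint (M1 \<Otimes>\<^sub>M M2) u" and v: "sqint (M1 \<Otimes>\<^sub>M M2) v" and \<rho>: "0 \<le> \<rho>"
    and le: "AE x in M1. sqint M2 (\<lambda>y. u (x, y)) \<longrightarrow> sqint M2 (\<lambda>y. v (x, y)) \<longrightarrow>
      (\<integral>y. u (x, y) * v (x, y) \<partial>M2) \<le> \<rho> * (nrm M2 (\<lambda>y. u (x, y)) * nrm M2 (\<lambda>y. v (x, y)))"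
  shows "(\<integral>w. u w * v w \<partial>(M1 \<Otimes>\<^sub>M M2)) \<le> \<rho> * (nrm (M1 \<Otimes>\<^sub>M M2) u * nrm (M1 \<Otimes>\<^sub>M M2) v)"
proof -
  \<comment> \<open>The fibre norm is a square-integrable function of the first coordinate, and by
    Fubini its norm is the norm on the product.\<close>
  have n: "sqint M1 (\<lambda>x. nrm M2 (\<lambda>y. z (x, y)))" 
     "nrm M1 (\<lambda>x. nrm M2 (\<lambda>y. z (x, y))) = nrm (M1 \<Otimes>\<^sub>M M2) z"
     "AE x in M1. sqint M2 (\<lambda>y. z (x, y))"
    if z: "sqint (M1 \<Otimes>\<^sub>M M2) z" for z
  proof -
    have zm [measurable]: "z \<in> borel_measurable (M1 \<Otimes>\<^sub>M M2)" using z by (simp add: sqint_def)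
    show "sqint M1 (\<lambda>x. nrm M2 (\<lambda>y. z (x, y)))"
      using integrable_fst'[OF sqint_square[OF z]]
      by (simp add: sqint_def nrm_power2) (simp add: nrm_def)
    show "nrm M1 (\<lambda>x. nrm M2 (\<lambda>y. z (x, y))) = nrm (M1 \<Otimes>\<^sub>M M2) z"
      using integral_fst'[OF sqint_square[OF z]]
      by (simp add: nrm_def[of M1] nrm_power2) (simp add: nrm_def)
    show "AE x in M1. sqint M2 (\<lambda>y. z (x, y))"
      using AE_integrable_fst'[OF sqint_square[OF z]] AE_space
      by eventually_elim (simp add: sqint_def)
  qed
  have "(\<integral>w. u w * v w \<partial>(M1 \<Otimes>\<^sub>M M2)) = (\<integral>x. \<integral>y. u (x, y) * v (x, y) \<partial>M2 \<partial>M1)"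
    using integral_fst'[OF integrable_sqint_mult[OF u v]] by simp
  also have "\<dots> \<le> (\<integral>x. \<rho> * (nrm M2 (\<lambda>y. u (x, y)) * nrm M2 (\<lambda>y. v (x, y))) \<partial>M1)"
  proof (rule integral_mono_AE)
    show "integrable M1 (\<lambda>x. \<integral>y. u (x, y) * v (x, y) \<partial>M2)"
      by (rule integrable_fst'[OF integrable_sqint_mult[OF u v]])
    show "integrable M1 (\<lambda>x. \<rho> * (nrm M2 (\<lambda>y. u (x, y)) * nrm M2 (\<lambda>y. v (x, y))))"
      by (intro integrable_mult_right integrable_sqint_mult n u v)
    show "AE x in M1. (\<integral>y. u (x, y) * v (x, y) \<partial>M2) \<le> \<rho> * (nrm M2 (\<lambda>y. u (x, y)) * nrm M2 (\<lambda>y. v (x, y)))"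
      using le n(3)[OF u] n(3)[OF v] by eventually_elim auto
  qed
  also have "\<dots> \<le> \<rho> * (nrm (M1 \<Otimes>\<^sub>M M2) u * nrm (M1 \<Otimes>\<^sub>M M2) v)"
    using integral_mult_le_nrm[OF n(1)[OF u] n(1)[OF v]] \<rho> n(2)[OF u] n(2)[OF v]
    by (simp add: mult_left_mono)
  finally show ?thesis .
qed

text \<open>By Cauchy--Schwarz against the constant 1, the square of a fibre mean is at most the
  fibre mean of the square.\<close>

lemma sqint_integral_snd:
  assumes u: "sqint (M1 \<Otimes>\<^sub>M M2) u"
  shows "sqint M1 (\<lambda>x. \<integral>y. u (x, y) \<partial>M2)"
proof -
  have zm [measurable]: "u \<in> borel_measurable (M1 \<Otimes>\<^sub>M M2)" using u by (simp add: sqint_def)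
  have "integrable M1 (\<lambda>x. (\<integral>y. u (x, y) \<partial>M2)\<^sup>2)"
  proof (rule Bochner_Integration.integrable_bound[OF integrable_fst'[OF sqint_square[OF u]]])
    show "AE x in M1. norm ((\<integral>y. u (x, y) \<partial>M2)\<^sup>2) \<le> norm (\<integral>y. (u (x, y))\<^sup>2 \<partial>M2)"
      using AE_integrable_fst'[OF sqint_square[OF u]] AE_space
    proof eventually_elim
      case (elim x)
      then have s: "sqint M2 (\<lambda>y. u (x, y))" by (simp add: sqint_def)
      have "\<bar>\<integral>y. u (x, y) \<partial>M2\<bar> \<le> nrm M2 (\<lambda>y. u (x, y))"
        using abs_integral_mult_le_nrm[OF s M2.sqint_const[of 1]]
        by (simp add: nrm_def[of _ "\<lambda>_. 1"] M2.prob_space)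
      from power_mono[OF this, of 2] show ?case
        by (simp add: nrm_power2)
    qed
  qed simp
  then show ?thesis by (simp add: sqint_def)
qed

lemma sqint_swap:
  "sqint (M1 \<Otimes>\<^sub>M M2) u \<Longrightarrow> sqint (M2 \<Otimes>\<^sub>M M1) (\<lambda>w. u (snd w, fst w))"
  using sqint_distr_iff[of "\<lambda>(x, y). (y, x)" "M2 \<Otimes>\<^sub>M M1" "M1 \<Otimes>\<^sub>M M2" u] distr_pair_swap
  by (simp add: sqintD split_beta)

lemma nrm_swap:
  "sqint (M1 \<Otimes>\<^sub>M M2) u \<Longrightarrow> nrm (M2 \<Otimes>\<^sub>M M1) (\<lambda>w. u (snd w, fst w)) = nrm (M1 \<Otimes>\<^sub>M M2) u"
  using nrm_distr[of "\<lambda>(x, y). (y, x)" "M2 \<Otimes>\<^sub>M M1" "M1 \<Otimes>\<^sub>M M2" u] distr_pair_swap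
  by (simp add: sqintD split_beta)

text \<open>Exchanging the two factors preserves integrals, norms and square-integrability, so
  \<open>fibrewise_bound\<close> applies.\<close>

lemma fibrewise_bound_snd:
  assumes u: "sqint (M1 \<Otimes>\<^sub>M M2) u" and v: "sqint (M1 \<Otimes>\<^sub>M M2) v" and \<rho>: "0 \<le> \<rho>"
    and le: "AE y in M2. sqint M1 (\<lambda>x. u (x, y)) \<longrightarrow> sqint M1 (\<lambda>x. v (x, y)) \<longrightarrow>
      (\<integral>x. u (x, y) * v (x, y) \<partial>M1) \<le> \<rho> * (nrm M1 (\<lambda>x. u (x, y)) * nrm M1 (\<lambda>x. v (x, y)))"
  shows "(\<integral>w. u w * v w \<partial>(M1 \<Otimes>\<^sub>M M2)) \<le> \<rho> * (nrm (M1 \<Otimes>\<^sub>M M2) u * nrm (M1 \<Otimes>\<^sub>M M2) v)"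
proof -
  interpret S: pair_prob_space M2 M1 ..
  have [measurable]: "u \<in> borel_measurable (M1 \<Otimes>\<^sub>M M2)" "v \<in> borel_measurable (M1 \<Otimes>\<^sub>M M2)"
    using u v by (simp_all add: sqintD)
  show ?thesis
    using S.fibrewise_bound[OF sqint_swap[OF u] sqint_swap[OF v] \<rho>] le
      integral_product_swap[of "\<lambda>w. u w * v w"] nrm_swap[OF u] nrm_swap[OF v]
    by (simp add: case_prod_unfold)
qed

text \<open>On each fibre the factor \<open>v x\<close> is constant and leaves an inner integral
  that vanishes. This is how a vanishing marginal yields orthogonality to functions of one
  coordinate.\<close>

lemma integral_mult_fst_eq_0:
  assumes u: "sqint (M1 \<Otimes>\<^sub>M M2) u" and v: "sqint M1 v"
    and 0: "AE x in M1. (\<integral>y. u (x, y) \<partial>M2) = 0"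
  shows "(\<integral>w. u w * v (fst w) \<partial>(M1 \<Otimes>\<^sub>M M2)) = 0"
proof -
  have "(\<integral>w. u w * v (fst w) \<partial>(M1 \<Otimes>\<^sub>M M2)) = (\<integral>x. \<integral>y. u (x, y) * v x \<partial>M2 \<partial>M1)"
    using integral_fst'[OF integrable_sqint_mult[OF u sqint_fst[OF v]]] by simp
  also have "\<dots> = 0"
    using 0 by (intro integral_eq_zero_AE) auto
  finally show ?thesis .
qed

lemma sqint_snd:
  assumes "sqint M2 u"
  shows "sqint (M1 \<Otimes>\<^sub>M M2) (\<lambda>w. u (snd w))"
proof -
  interpret S: pair_prob_space M2 M1 ..
  show ?thesis using S.sqint_swap[OF S.sqint_fst[OF assms]] by simp
qed

lemma sqint_integral_fst:
  assumes "sqint (M1 \<Otimes>\<^sub>M M2) u"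
  shows "sqint M2 (\<lambda>y. \<integral>x. u (x, y) \<partial>M1)"
proof -
  interpret S: pair_prob_space M2 M1 ..
  show ?thesis using S.sqint_integral_snd[OF sqint_swap[OF assms]] by simp
qed

lemma integral_mult_snd_eq_0:
  assumes u: "sqint (M1 \<Otimes>\<^sub>M M2) u" and v: "sqint M2 v"
    and 0: "AE y in M2. (\<integral>x. u (x, y) \<partial>M1) = 0"
  shows "(\<integral>w. u w * v (snd w) \<partial>(M1 \<Otimes>\<^sub>M M2)) = 0"
proof -
  interpret S: pair_prob_space M2 M1 ..
  have "(\<lambda>w. u w * v (snd w)) \<in> borel_measurable (M1 \<Otimes>\<^sub>M M2)"
    using sqintD[OF u] sqintD[OF sqint_snd[OF v]] by measurable
  then show ?thesis
    using S.integral_mult_fst_eq_0[OF sqint_swap[OF u] v] 0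
      integral_product_swap[of "\<lambda>w. u w * v (snd w)"]
    by (simp add: case_prod_unfold)
qed

text \<open>Integrating the interaction part over \<open>y\<close> cancels the first marginal
  against itself and leaves minus the total mean, which is 0. The statement is almost sure because
  only almost every section is integrable.\<close>

lemma AE_integral_remainder_snd:
  assumes u: "sqint (M1 \<Otimes>\<^sub>M M2) u" and u0: "(\<integral>w. u w \<partial>(M1 \<Otimes>\<^sub>M M2)) = 0"
  shows "AE x in M1. (\<integral>y. u (x, y) - (\<integral>y. u (x, y) \<partial>M2) - (\<integral>x. u (x, y) \<partial>M1) \<partial>M2) = 0"
proof -
  have "integrable M2 (\<lambda>y. \<integral>x. u (x, y) \<partial>M1)"
    by (rule M2.integrable_sqint[OF sqint_integral_fst[OF u]])
  moreover have "(\<integral>y. \<integral>x. u (x, y) \<partial>M1 \<partial>M2) = 0"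
    using integral_snd[of "\<lambda>x y. u (x, y)"] integrable_sqint[OF u] u0 by (simp add: case_prod_unfold)
  ultimately have *: "(\<integral>y. u (x, y) - (\<integral>y. u (x, y) \<partial>M2) - (\<integral>x. u (x, y) \<partial>M1) \<partial>M2) = 0"
    if "integrable M2 (\<lambda>y. u (x, y))" for x
    using that by (simp add: M2.prob_space)
  show ?thesis
    by (rule eventually_mono[OF AE_integrable_fst'[OF integrable_sqint[OF u]]]) (rule *)
qed

lemma AE_integral_remainder_fst:
  assumes u: "sqint (M1 \<Otimes>\<^sub>M M2) u" and u0: "(\<integral>w. u w \<partial>(M1 \<Otimes>\<^sub>M M2)) = 0"
  shows "AE y in M2. (\<integral>x. u (x, y) - (\<integral>y. u (x, y) \<partial>M2) - (\<integral>x. u (x, y) \<partial>M1) \<partial>M1) = 0"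
proof -
  interpret S: pair_prob_space M2 M1 ..
  have "(\<integral>w. u (snd w, fst w) \<partial>(M2 \<Otimes>\<^sub>M M1)) = 0"
    using integral_product_swap[of u] sqintD[OF u] u0 by (simp add: case_prod_unfold)
  from S.AE_integral_remainder_snd[OF sqint_swap[OF u] this] show ?thesis
    by (simp add: algebra_simps)
qed

end

section \<open>Products of two independent pairs\<close>

text \<open>The Doob--Dynkin factorisation. For rational \<open>q\<close> the set where
  \<open>f < q\<close> is the preimage of some \<open>B q\<close>, and \<open>g\<close> is recovered
  as the infimum of the rationals \<open>q\<close> with \<open>y\<close> in
  \<open>B q\<close>.\<close>

lemma borel_measurable_vimage_algebra_factor:
  fixes f :: "'a \<Rightarrow> real"
  assumes f: "f \<in> borel_measurable (vimage_algebra S X N)" and X: "X \<in> S \<rightarrow> space N"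
  obtains g where "g \<in> borel_measurable N" "\<And>x. x \<in> S \<Longrightarrow> f x = g (X x)"
proof -
  have "\<exists>B\<in>sets N. {x \<in> S. f x < of_rat q} = X -` B \<inter> S" for q
  proof -
    have "{x \<in> space (vimage_algebra S X N). f x < of_rat q} \<in> sets (vimage_algebra S X N)"
      using f by measurable
    then show ?thesis
      by (auto simp: sets_vimage_algebra2[OF X])
  qed
  then obtain B where B: "\<And>q. B q \<in> sets N" "\<And>q. {x \<in> S. f x < of_rat q} = X -` B q \<inter> S"
    by metis
  \<comment> \<open>Extended reals are used because the infimum can be infinite at points outside
    the range of \<open>X\<close>. The index set is countable, hence \<open>E\<close> is
    measurable.\<close>
  define E :: "_ \<Rightarrow> ereal" where "E y = (INF q. if y \<in> B q then ereal (of_rat q) else \<infinity>)" for y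
  note B(1)[measurable]
  have Em: "E \<in> borel_measurable N"
    unfolding E_def by measurable
  have E: "E (X x) = ereal (f x)" if x: "x \<in> S" for x
  proof (rule antisym)
    have mem: "X x \<in> B q \<longleftrightarrow> f x < of_rat q" for q
      using B(2)[of q] x by auto
    show "ereal (f x) \<le> E (X x)"
      unfolding E_def by (rule INF_greatest) (simp add: mem)
    show "E (X x) \<le> ereal (f x)"
    proof (rule ereal_le_epsilon2)
      fix e :: real assume "0 < e"
      then obtain q where q: "f x < of_rat q" "of_rat q < f x + e"
        using of_rat_dense[of "f x" "f x + e"] by auto
      have "E (X x) \<le> ereal (of_rat q)"
        unfolding E_def using q by (intro INF_lower2[of q]) (auto simp: mem)
      also have "\<dots> \<le> ereal (f x) + ereal e"
        using q by simp
      finally show "E (X x) \<le> ereal (f x) + ereal e" .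
    qed
  qed
  show thesis
  proof
    show "(\<lambda>y. real_of_ereal (E y)) \<in> borel_measurable N"
      using Em by measurable
  qed (simp add: E)
qed

context pair_prob_space
begin

text \<open>
  The conditional expectation of \<open>g(X\<^sub>1, X\<^sub>2)\<close> given \<open>(X\<^sub>1, Y\<^sub>2)\<close>, realised as a function
  \<open>k(X\<^sub>1, Y\<^sub>2)\<close>: its sections in either variable are then again functions of \<open>X\<^sub>1\<close> or of
  \<open>Y\<^sub>2\<close> alone.
\<close>

lemma conditional_expectation_mixed_pair:
  assumes [measurable]: "X1 \<in> measurable M1 N1" "X2 \<in> measurable M2 N2" "Y2 \<in> measurable M2 N2'"
    and g [measurable]: "g \<in> borel_measurable (N1 \<Otimes>\<^sub>M N2)"
    and G: "sqint (M1 \<Otimes>\<^sub>M M2) (\<lambda>w. g (X1 (fst w), X2 (snd w)))"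
  shows "\<exists>k\<in>borel_measurable (N1 \<Otimes>\<^sub>M N2').
    sqint (M1 \<Otimes>\<^sub>M M2) (\<lambda>w. k (X1 (fst w), Y2 (snd w))) \<and>
    (\<forall>l\<in>borel_measurable (N1 \<Otimes>\<^sub>M N2').
       integrable (M1 \<Otimes>\<^sub>M M2) (\<lambda>w. l (X1 (fst w), Y2 (snd w)) * g (X1 (fst w), X2 (snd w))) \<longrightarrow>
       (\<integral>w. l (X1 (fst w), Y2 (snd w)) * k (X1 (fst w), Y2 (snd w)) \<partial>(M1 \<Otimes>\<^sub>M M2)) =
       (\<integral>w. l (X1 (fst w), Y2 (snd w)) * g (X1 (fst w), X2 (snd w)) \<partial>(M1 \<Otimes>\<^sub>M M2)))"
proof -
  let ?Q = "M1 \<Otimes>\<^sub>M M2"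
  let ?Z = "\<lambda>w. (X1 (fst w), Y2 (snd w))"
  let ?G = "\<lambda>w. g (X1 (fst w), X2 (snd w))"
  define S where "S = vimage_algebra (space ?Q) ?Z (N1 \<Otimes>\<^sub>M N2')"
  have Zm: "?Z \<in> measurable ?Q (N1 \<Otimes>\<^sub>M N2')" by measurable
  then have ZS: "?Z \<in> space ?Q \<rightarrow> space (N1 \<Otimes>\<^sub>M N2')"
    by (intro Pi_I) (rule measurable_space)
  have sub: "subalgebra ?Q S"
    unfolding subalgebra_def S_def using Zm
    by (auto simp: sets_vimage_algebra2[OF ZS] intro: measurable_sets)
  interpret C: finite_measure_subalgebra ?Q S
    by unfold_locales (rule sub)
  define c where "c = real_cond_exp ?Q S ?G"
  have Gi: "integrable ?Q ?G" by (rule integrable_sqint[OF G])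
  have "c \<in> borel_measurable S" unfolding c_def by simp
  then obtain k where km [measurable]: "k \<in> borel_measurable (N1 \<Otimes>\<^sub>M N2')"
    and k: "\<And>w. w \<in> space ?Q \<Longrightarrow> c w = k (?Z w)"
    unfolding S_def by (rule borel_measurable_vimage_algebra_factor[OF _ ZS]) blast
  \<comment> \<open>Conditional Jensen for the square keeps the conditional expectation
    square-integrable.\<close>
  have "integrable ?Q (\<lambda>w. (c w)\<^sup>2)"
    unfolding c_def
    by (rule C.integrable_convex_cond_exp[where I=UNIV and q="\<lambda>x. x\<^sup>2"])
       (use Gi sqint_square[OF G] convex_power2 in auto)
  moreover have "integrable ?Q (\<lambda>w. (c w)\<^sup>2) \<longleftrightarrow> integrable ?Q (\<lambda>w. (k (?Z w))\<^sup>2)"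
    by (rule Bochner_Integration.integrable_cong) (simp_all add: k)
  ultimately have 1: "sqint ?Q (\<lambda>w. k (?Z w))"
    by (simp add: sqint_def)
  have 2: "(\<integral>w. l (?Z w) * k (?Z w) \<partial>?Q) = (\<integral>w. l (?Z w) * ?G w \<partial>?Q)"
    if lm: "l \<in> borel_measurable (N1 \<Otimes>\<^sub>M N2')" and i: "integrable ?Q (\<lambda>w. l (?Z w) * ?G w)" for l
  proof -
    have "?Z \<in> measurable S (N1 \<Otimes>\<^sub>M N2')"
      unfolding S_def by (rule measurable_vimage_algebra1[OF ZS])
    from measurable_compose[OF this lm] have "(\<lambda>w. l (?Z w)) \<in> borel_measurable S" .
    from C.real_cond_exp_intg(2)[OF i this] have "(\<integral>w. l (?Z w) * c w \<partial>?Q) = (\<integral>w. l (?Z w) * ?G w \<partial>?Q)"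
      unfolding c_def by simp
    moreover have "(\<integral>w. l (?Z w) * c w \<partial>?Q) = (\<integral>w. l (?Z w) * k (?Z w) \<partial>?Q)"
      by (rule Bochner_Integration.integral_cong) (auto simp: k)
    ultimately show ?thesis by simp
  qed
  show ?thesis using km 1 2 by blast
qed

text \<open>Rectangles form an intersection-stable generator, so \<open>D\<close> integrates to 0
  over every event of the pair \<open>(Y1, Y2)\<close>. Its conditional expectation given this pair
  is then 0, which makes it orthogonal to all square-integrable functions of the pair.\<close>

lemma integral_eq_0_of_rectangles:
  assumes [measurable]: "Y1 \<in> measurable M1 N1'" "Y2 \<in> measurable M2 N2'"
    and D: "sqint (M1 \<Otimes>\<^sub>M M2) D"
    and rect: "\<And>A B. A \<in> sets N1' \<Longrightarrow> B \<in> sets N2' \<Longrightarrow>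
      (\<integral>w. indicator A (Y1 (fst w)) * indicator B (Y2 (snd w)) * D w \<partial>(M1 \<Otimes>\<^sub>M M2)) = 0"
    and h [measurable]: "h \<in> borel_measurable (N1' \<Otimes>\<^sub>M N2')"
    and H: "sqint (M1 \<Otimes>\<^sub>M M2) (\<lambda>w. h (Y1 (fst w), Y2 (snd w)))"
  shows "(\<integral>w. h (Y1 (fst w), Y2 (snd w)) * D w \<partial>(M1 \<Otimes>\<^sub>M M2)) = 0"
proof -
  let ?Q = "M1 \<Otimes>\<^sub>M M2"
  let ?W = "\<lambda>w. (Y1 (fst w), Y2 (snd w))"
  have Dm [measurable]: "D \<in> borel_measurable ?Q" by (rule sqintD[OF D])
  have Di: "integrable ?Q D" by (rule integrable_sqint[OF D])
  have indi: "integrable ?Q (\<lambda>w. indicator C (?W w) * D w)" if [measurable]: "C \<in> sets (N1' \<Otimes>\<^sub>M N2')" for C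
    by (rule Bochner_Integration.integrable_bound[OF Di]) (auto split: split_indicator)
  have ind: "(\<integral>w. indicator C (?W w) * D w \<partial>?Q) = 0" if "C \<in> sets (N1' \<Otimes>\<^sub>M N2')" for C
  proof -
    have "C \<in> sigma_sets (space N1' \<times> space N2') {a \<times> b |a b. a \<in> sets N1' \<and> b \<in> sets N2'}"
      using that by (simp add: sets_pair_measure)
    from Int_stable_pair_measure_generator pair_measure_closed this show ?thesis
    proof (induction rule: sigma_sets_induct_disjoint)
      case (basic C)
      then obtain A B where "C = A \<times> B" "A \<in> sets N1'" "B \<in> sets N2'" by auto
      then show ?case using rect[of A B] by (simp add: indicator_times)
    next
      case empty then show ?case by simp
    next
      \<comment> \<open>Complements require the integral of \<open>D\<close> over the whole space to
        vanish; the rectangle formed by both full spaces supplies this.\<close>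
      case (compl C)
      have "(\<integral>w. 1 * D w \<partial>?Q) = 0"
      proof -
        have "(\<integral>w. indicator (space N1') (Y1 (fst w)) * indicator (space N2') (Y2 (snd w)) * D w \<partial>?Q) = (\<integral>w. D w \<partial>?Q)"
          using measurable_space[OF assms(1)] measurable_space[OF assms(2)]
          by (intro Bochner_Integration.integral_cong) (auto simp: space_pair_measure)
        then show ?thesis using rect[of "space N1'" "space N2'"] by simp
      qed
      moreover have "(\<integral>w. indicator (space N1' \<times> space N2' - C) (?W w) * D w \<partial>?Q)
        = (\<integral>w. 1 * D w - indicator C (?W w) * D w \<partial>?Q)"
        using measurable_space[OF assms(1)] measurable_space[OF assms(2)]
        by (intro Bochner_Integration.integral_cong) (auto simp: space_pair_measure split: split_indicator)
      moreover have "C \<in> sets (N1' \<Otimes>\<^sub>M N2')"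
        using compl by (simp add: sets_pair_measure)
      ultimately show ?case
        using compl(2) Di indi[of C] by simp
    next
      case (union C)
      have Cm [measurable]: "C i \<in> sets (N1' \<Otimes>\<^sub>M N2')" for i
        using union(2) by (auto simp: sets_pair_measure)
      have eq: "(LINT w:?W -` A \<inter> space ?Q|?Q. D w) = (\<integral>w. indicator A (?W w) * D w \<partial>?Q)" for A
        unfolding set_lebesgue_integral_def
        by (intro Bochner_Integration.integral_cong) (auto split: split_indicator)
      have "(LINT w:(\<Union>i. ?W -` C i \<inter> space ?Q)|?Q. D w) = (\<Sum>i. (LINT w:?W -` C i \<inter> space ?Q|?Q. D w))"
      proof (rule lebesgue_integral_countable_add)
        show "set_integrable ?Q (\<Union>i. ?W -` C i \<inter> space ?Q) D"
          unfolding set_integrable_def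
          by (intro integrable_mult_indicator Di) measurable
      qed (use union(1) in \<open>auto simp: disjoint_family_on_def\<close>)
      also have "(\<Union>i. ?W -` C i \<inter> space ?Q) = ?W -` (\<Union>i. C i) \<inter> space ?Q" by auto
      finally show ?case unfolding eq union(3) by simp
    qed
  qed
  define F where "F = vimage_algebra (space ?Q) ?W (N1' \<Otimes>\<^sub>M N2')"
  have Wm: "?W \<in> measurable ?Q (N1' \<Otimes>\<^sub>M N2')" by measurable
  then have WF: "?W \<in> space ?Q \<rightarrow> space (N1' \<Otimes>\<^sub>M N2')"
    by (intro Pi_I) (rule measurable_space)
  have sub: "subalgebra ?Q F"
    unfolding subalgebra_def F_def using Wm
    by (auto simp: sets_vimage_algebra2[OF WF] intro: measurable_sets)
  interpret C: finite_measure_subalgebra ?Q F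
    by unfold_locales (rule sub)
  have z: "AE w in ?Q. real_cond_exp ?Q F D w = 0"
  proof (rule C.real_cond_exp_charact)
    fix A assume "A \<in> sets F"
    then obtain C where C: "C \<in> sets (N1' \<Otimes>\<^sub>M N2')" "A = ?W -` C \<inter> space ?Q"
      by (auto simp: F_def sets_vimage_algebra2[OF WF])
    have "(LINT w:A|?Q. D w) = (\<integral>w. indicator C (?W w) * D w \<partial>?Q)"
      unfolding set_lebesgue_integral_def C
      by (intro Bochner_Integration.integral_cong) (auto split: split_indicator)
    then show "(LINT w:A|?Q. D w) = (LINT w:A|?Q. 0)"
      using ind[OF C(1)] by (simp add: set_lebesgue_integral_def)
  qed (use Di in auto)
  have "?W \<in> measurable F (N1' \<Otimes>\<^sub>M N2')"
    unfolding F_def by (rule measurable_vimage_algebra1[OF WF])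
  from measurable_compose[OF this h] have hF: "(\<lambda>w. h (?W w)) \<in> borel_measurable F" .
  \<comment> \<open>Since \<open>h (?W w)\<close> is measurable for the generated sigma-algebra,
    \<open>D\<close> may be replaced by its conditional expectation.\<close>
  have "(\<integral>w. h (?W w) * D w \<partial>?Q) = (\<integral>w. h (?W w) * real_cond_exp ?Q F D w \<partial>?Q)"
    using C.real_cond_exp_intg(2)[OF integrable_sqint_mult[OF H D] hF Dm] by simp
  also have "\<dots> = 0"
    using z by (intro integral_eq_zero_AE) auto
  finally show ?thesis .
qed

end

section \<open>Maximal correlation as an inequality between norms\<close>

text \<open>The bound \<open>\<rho>\<close> on the maximal correlation, written without quotients so
  that constants need no special treatment.\<close>

definition maxcorr_le ::
  "'a measure \<Rightarrow> 'b measure \<Rightarrow> ('a \<Rightarrow> 'b) \<Rightarrow> 'c measure \<Rightarrow> ('a \<Rightarrow> 'c) \<Rightarrow> real \<Rightarrow> bool" where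
  "maxcorr_le M N X N' Y \<rho> \<longleftrightarrow>
    (\<forall>g\<in>borel_measurable N. \<forall>h\<in>borel_measurable N'.
      sqint M (\<lambda>x. g (X x)) \<longrightarrow> sqint M (\<lambda>x. h (Y x)) \<longrightarrow>
      (\<integral>x. g (X x) \<partial>M) = 0 \<or> (\<integral>x. h (Y x) \<partial>M) = 0 \<longrightarrow>
      (\<integral>x. g (X x) * h (Y x) \<partial>M) \<le> \<rho> * (nrm M (\<lambda>x. g (X x)) * nrm M (\<lambda>x. h (Y x))))"

lemma maxcorr_leD:
  assumes "maxcorr_le M N X N' Y \<rho>" "g \<in> borel_measurable N" "h \<in> borel_measurable N'"
    "sqint M (\<lambda>x. g (X x))" "sqint M (\<lambda>x. h (Y x))"
    "(\<integral>x. g (X x) \<partial>M) = 0 \<or> (\<integral>x. h (Y x) \<partial>M) = 0"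
  shows "(\<integral>x. g (X x) * h (Y x) \<partial>M) \<le> \<rho> * (nrm M (\<lambda>x. g (X x)) * nrm M (\<lambda>x. h (Y x)))"
  using assms unfolding maxcorr_le_def by blast

text \<open>If one of the two means is 0, the expected product equals that of the centred functions,
  and centring does not increase norms. It therefore suffices to test functions that are both
  centred.\<close>

lemma (in prob_space) maxcorr_leI:
  assumes \<rho>: "0 \<le> \<rho>"
    and *: "\<And>g h. g \<in> borel_measurable N \<Longrightarrow> h \<in> borel_measurable N' \<Longrightarrow>
      sqint M (\<lambda>x. g (X x)) \<Longrightarrow> sqint M (\<lambda>x. h (Y x)) \<Longrightarrow>
      expectation (\<lambda>x. g (X x)) = 0 \<Longrightarrow> expectation (\<lambda>x. h (Y x)) = 0 \<Longrightarrow>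
      expectation (\<lambda>x. g (X x) * h (Y x)) \<le> \<rho> * (nrm M (\<lambda>x. g (X x)) * nrm M (\<lambda>x. h (Y x)))"
  shows "maxcorr_le M N X N' Y \<rho>"
  unfolding maxcorr_le_def
proof (intro ballI impI)
  fix g h assume gm [measurable]: "g \<in> borel_measurable N" and hm [measurable]: "h \<in> borel_measurable N'"
    and g: "sqint M (\<lambda>x. g (X x))" and h: "sqint M (\<lambda>x. h (Y x))"
    and 0: "expectation (\<lambda>x. g (X x)) = 0 \<or> expectation (\<lambda>x. h (Y x)) = 0"
  define c d where "c = expectation (\<lambda>x. g (X x))" and "d = expectation (\<lambda>x. h (Y x))"
  note i = integrable_sqint[OF g] integrable_sqint[OF h] integrable_sqint_mult[OF g h]
  have "expectation (\<lambda>x. g (X x) * h (Y x)) = expectation (\<lambda>x. (g (X x) - c) * (h (Y x) - d))"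
    using 0 i by (auto simp: c_def d_def algebra_simps prob_space)
  also have "\<dots> \<le> \<rho> * (nrm M (\<lambda>x. g (X x) - c) * nrm M (\<lambda>x. h (Y x) - d))"
    using sqint_center[OF g] sqint_center[OF h] i(1,2)
    by (intro *[of "\<lambda>x. g x - c" "\<lambda>x. h x - d"]) (auto simp: c_def d_def prob_space)
  also have "\<dots> \<le> \<rho> * (nrm M (\<lambda>x. g (X x)) * nrm M (\<lambda>x. h (Y x)))"
    using nrm_center_le[OF g] nrm_center_le[OF h] \<rho>
    by (intro mult_left_mono mult_mono) (auto simp: c_def d_def)
  finally show "expectation (\<lambda>x. g (X x) * h (Y x)) \<le> \<rho> * (nrm M (\<lambda>x. g (X x)) * nrm M (\<lambda>x. h (Y x)))" .
qed

context pair_prob_space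
begin

text \<open>
  With \<open>k(X\<^sub>1, Y\<^sub>2) = E[g | X\<^sub>1, Y\<^sub>2]\<close> the proof shows \<open>E[g h] = E[k h]\<close> and
  \<open>\<parallel>k\<parallel>\<^sup>2 = E[g k]\<close>; the hypothesis on the second pair bounds \<open>E[g k]\<close> for fixed first coordinate,
  the one on the first pair bounds \<open>E[k h]\<close> for fixed second coordinate. No centring of \<open>k\<close> is
  available, which is why \<^const>\<open>maxcorr_le\<close> asks for only one of the two functions to be centred.
\<close>

lemma integral_mult_le_tensor:
  assumes m [measurable]: "X1 \<in> measurable M1 N1" "Y1 \<in> measurable M1 N1'"
      "X2 \<in> measurable M2 N2" "Y2 \<in> measurable M2 N2'"
    and \<rho>: "0 \<le> \<rho>"
    and mc1: "maxcorr_le M1 N1 X1 N1' Y1 \<rho>" and mc2: "maxcorr_le M2 N2 X2 N2' Y2 \<rho>"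
    and g [measurable]: "g \<in> borel_measurable (N1 \<Otimes>\<^sub>M N2)" and h [measurable]: "h \<in> borel_measurable (N1' \<Otimes>\<^sub>M N2')"
    and G: "sqint (M1 \<Otimes>\<^sub>M M2) (\<lambda>w. g (X1 (fst w), X2 (snd w)))"
    and H: "sqint (M1 \<Otimes>\<^sub>M M2) (\<lambda>w. h (Y1 (fst w), Y2 (snd w)))"
    and g0: "AE x in M1. (\<integral>y. g (X1 x, X2 y) \<partial>M2) = 0"
    and h0: "AE y in M2. (\<integral>x. h (Y1 x, Y2 y) \<partial>M1) = 0"
  shows "(\<integral>w. g (X1 (fst w), X2 (snd w)) * h (Y1 (fst w), Y2 (snd w)) \<partial>(M1 \<Otimes>\<^sub>M M2))
    \<le> \<rho>\<^sup>2 * (nrm (M1 \<Otimes>\<^sub>M M2) (\<lambda>w. g (X1 (fst w), X2 (snd w))) *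
            nrm (M1 \<Otimes>\<^sub>M M2) (\<lambda>w. h (Y1 (fst w), Y2 (snd w))))"
proof -
  let ?Q = "M1 \<Otimes>\<^sub>M M2"
  let ?G = "\<lambda>w. g (X1 (fst w), X2 (snd w))"
  let ?H = "\<lambda>w. h (Y1 (fst w), Y2 (snd w))"
  obtain k where k [measurable]: "k \<in> borel_measurable (N1 \<Otimes>\<^sub>M N2')"
    and K: "sqint ?Q (\<lambda>w. k (X1 (fst w), Y2 (snd w)))"
    and Kl: "\<And>l. l \<in> borel_measurable (N1 \<Otimes>\<^sub>M N2') \<Longrightarrow>
       integrable ?Q (\<lambda>w. l (X1 (fst w), Y2 (snd w)) * ?G w) \<Longrightarrow>
       (\<integral>w. l (X1 (fst w), Y2 (snd w)) * k (X1 (fst w), Y2 (snd w)) \<partial>?Q) =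
       (\<integral>w. l (X1 (fst w), Y2 (snd w)) * ?G w \<partial>?Q)"
    using conditional_expectation_mixed_pair[OF m(1,3,4) g G] by blast
  let ?K = "\<lambda>w. k (X1 (fst w), Y2 (snd w))"
  define D where "D w = ?G w - ?K w" for w
  have D: "sqint ?Q D" unfolding D_def by (rule sqint_diff[OF G K])
  have Dm [measurable]: "D \<in> borel_measurable ?Q" by (rule sqintD[OF D])
  have Di: "integrable ?Q D" by (rule integrable_sqint[OF D])
  have "(\<integral>w. ?H w * D w \<partial>?Q) = 0"
  proof (rule integral_eq_0_of_rectangles[OF m(2,4) D _ h H])
    fix A B assume [measurable]: "A \<in> sets N1'" "B \<in> sets N2'"
    \<comment> \<open>\<open>\<Delta> (X1 x)\<close> is the integral of \<open>D\<close> over the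
      second coordinate, restricted to \<open>Y2\<close> in \<open>B\<close>. Once it vanishes for
      almost every \<open>x\<close>, any weight depending on the first coordinate, such as the
      indicator of \<open>A\<close> at \<open>Y1 x\<close>, may be inserted.\<close>
    define \<Delta> where "\<Delta> x = (\<integral>y. indicator B (Y2 y) * (g (x, X2 y) - k (x, Y2 y)) \<partial>M2)" for x
    have \<Delta>m [measurable]: "\<Delta> \<in> borel_measurable N1"
      unfolding \<Delta>_def by measurable
    txt \<open>This test function turns the integral of \<open>l D\<close>, which vanishes, into that of \<open>\<bar>\<Delta>(X\<^sub>1)\<bar>\<close>.\<close>
    define l where "l z = sgn (\<Delta> (fst z)) * indicator B (snd z)" for z
    have lm [measurable]: "l \<in> borel_measurable (N1 \<Otimes>\<^sub>M N2')"
      unfolding l_def by measurable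
    have lb: "\<bar>l z\<bar> \<le> 1" for z
      by (auto simp: l_def sgn_if split: split_indicator)
    have li: "integrable ?Q (\<lambda>w. l (X1 (fst w), Y2 (snd w)) * F w)" if F: "sqint ?Q F" for F
      by (rule Bochner_Integration.integrable_bound[OF integrable_sqint[OF F]])
         (use F lb in \<open>auto simp: abs_mult sqintD intro!: mult_left_le_one_le\<close>)
    have inner: "(\<integral>y. l (X1 x, Y2 y) * D (x, y) \<partial>M2) = \<bar>\<Delta> (X1 x)\<bar>" for x
    proof -
      have "(\<integral>y. l (X1 x, Y2 y) * D (x, y) \<partial>M2) =
        (\<integral>y. sgn (\<Delta> (X1 x)) * (indicator B (Y2 y) * (g (X1 x, X2 y) - k (X1 x, Y2 y))) \<partial>M2)"
        by (simp add: l_def D_def mult.assoc)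
      also have "\<dots> = sgn (\<Delta> (X1 x)) * \<Delta> (X1 x)"
        by (simp only: integral_mult_right_zero \<Delta>_def)
      finally show ?thesis by (simp add: abs_sgn mult.commute)
    qed
    have "0 = (\<integral>w. l (X1 (fst w), Y2 (snd w)) * D w \<partial>?Q)"
      using Kl[OF lm li[OF G]] li[OF G] li[OF K] by (simp add: D_def right_diff_distrib)
    also have "\<dots> = (\<integral>x. \<integral>y. l (X1 x, Y2 y) * D (x, y) \<partial>M2 \<partial>M1)"
      using integral_fst'[OF li[OF D]] by simp
    also have "\<dots> = (\<integral>x. \<bar>\<Delta> (X1 x)\<bar> \<partial>M1)"
      by (simp add: inner)
    finally have "(\<integral>x. \<bar>\<Delta> (X1 x)\<bar> \<partial>M1) = 0" by simp
    moreover have "integrable M1 (\<lambda>x. \<bar>\<Delta> (X1 x)\<bar>)"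
      using integrable_fst'[OF li[OF D]]
      by (simp add: inner)
    ultimately have ae: "AE x in M1. \<Delta> (X1 x) = 0"
      by (subst (asm) integral_nonneg_eq_0_iff_AE) auto
    have i: "integrable ?Q (\<lambda>w. indicator A (Y1 (fst w)) * indicator B (Y2 (snd w)) * D w)"
      by (rule Bochner_Integration.integrable_bound[OF Di]) (auto split: split_indicator)
    have "(\<integral>w. indicator A (Y1 (fst w)) * indicator B (Y2 (snd w)) * D w \<partial>?Q)
      = (\<integral>x. indicator A (Y1 x) * \<Delta> (X1 x) \<partial>M1)"
      using integral_fst'[OF i] by (simp add: D_def \<Delta>_def mult.assoc)
    also have "\<dots> = 0"
      using ae by (intro integral_eq_zero_AE) auto
    finally show "(\<integral>w. indicator A (Y1 (fst w)) * indicator B (Y2 (snd w)) * D w \<partial>?Q) = 0" .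
  qed
  then have GH: "(\<integral>w. ?G w * ?H w \<partial>?Q) = (\<integral>w. ?K w * ?H w \<partial>?Q)"
    using integrable_sqint_mult[OF G H] integrable_sqint_mult[OF K H]
    by (simp add: D_def right_diff_distrib mult.commute)
  \<comment> \<open>The projection property is applied with \<open>k\<close> itself as test
    function.\<close>
  have "(nrm ?Q ?K)\<^sup>2 = (\<integral>w. ?G w * ?K w \<partial>?Q)"
    using Kl[OF k integrable_sqint_mult[OF K G]] by (simp add: nrm_power2) (simp add: power2_eq_square mult.commute)
  also have "\<dots> \<le> \<rho> * (nrm ?Q ?G * nrm ?Q ?K)"
  proof (rule fibrewise_bound[OF G K \<rho>])
    show "AE x in M1. sqint M2 (\<lambda>y. ?G (x, y)) \<longrightarrow> sqint M2 (\<lambda>y. ?K (x, y)) \<longrightarrow>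
      (\<integral>y. ?G (x, y) * ?K (x, y) \<partial>M2) \<le> \<rho> * (nrm M2 (\<lambda>y. ?G (x, y)) * nrm M2 (\<lambda>y. ?K (x, y)))"
      using g0 AE_space
    proof eventually_elim
      case (elim x)
      from elim(2) have [measurable]: "X1 x \<in> space N1" by (rule measurable_space[OF m(1)])
      show ?case
        using maxcorr_leD[OF mc2, of "\<lambda>z. g (X1 x, z)" "\<lambda>z. k (X1 x, z)"] elim(1) by simp
    qed
  qed
  finally have "nrm ?Q ?K * nrm ?Q ?K \<le> (\<rho> * nrm ?Q ?G) * nrm ?Q ?K"
    by (simp add: power2_eq_square mult.assoc)
  then have nK: "nrm ?Q ?K \<le> \<rho> * nrm ?Q ?G"
    using \<rho> by (cases "nrm ?Q ?K = 0") (auto simp: mult_le_cancel_right less_le)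
  have "(\<integral>w. ?K w * ?H w \<partial>?Q) \<le> \<rho> * (nrm ?Q ?K * nrm ?Q ?H)"
  proof (rule fibrewise_bound_snd[OF K H \<rho>])
    show "AE y in M2. sqint M1 (\<lambda>x. ?K (x, y)) \<longrightarrow> sqint M1 (\<lambda>x. ?H (x, y)) \<longrightarrow>
      (\<integral>x. ?K (x, y) * ?H (x, y) \<partial>M1) \<le> \<rho> * (nrm M1 (\<lambda>x. ?K (x, y)) * nrm M1 (\<lambda>x. ?H (x, y)))"
      using h0 AE_space
    proof eventually_elim
      case (elim y)
      from elim(2) have [measurable]: "Y2 y \<in> space N2'" by (rule measurable_space[OF m(4)])
      show ?case
        using maxcorr_leD[OF mc1, of "\<lambda>z. k (z, Y2 y)" "\<lambda>z. h (z, Y2 y)"] elim(1) by simp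
    qed
  qed
  also have "\<dots> \<le> \<rho> * (\<rho> * nrm ?Q ?G * nrm ?Q ?H)"
    using nK \<rho> by (intro mult_left_mono mult_right_mono) auto
  finally show ?thesis
    unfolding GH by (simp add: power2_eq_square mult.assoc)
qed

end

text \<open>The library's \<open>indep_var\<close> forces both random variables to take values in the same type.\<close>

definition indep_rv ::
  "'a measure \<Rightarrow> 'b measure \<Rightarrow> ('a \<Rightarrow> 'b) \<Rightarrow> 'c measure \<Rightarrow> ('a \<Rightarrow> 'c) \<Rightarrow> bool" where
  "indep_rv M S A T B \<longleftrightarrow> A \<in> measurable M S \<and> B \<in> measurable M T \<and>
    distr M S A \<Otimes>\<^sub>M distr M T B = distr M (S \<Otimes>\<^sub>M T) (\<lambda>x. (A x, B x))"

lemma indep_rvD: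
  assumes "indep_rv M S A T B"
  shows "A \<in> measurable M S" "B \<in> measurable M T"
  using assms by (simp_all add: indep_rv_def)

section \<open>Independence and its realisation on a product space\<close>

lemma (in prob_space) indep_rv_compose:
  assumes ind: "indep_rv M S A T B" and \<phi>: "\<phi> \<in> measurable S S'" and \<psi>: "\<psi> \<in> measurable T T'"
  shows "indep_rv M S' (\<lambda>x. \<phi> (A x)) T' (\<lambda>x. \<psi> (B x))"
proof -
  note AB [measurable] = indep_rvD[OF ind]
  note \<phi> [measurable] and \<psi> [measurable]
  have "prob_space (distr (distr M T B) T' \<psi>)"
    by (intro prob_space.prob_space_distr prob_space_distr) simp_all
  then have "distr (distr M S A) S' \<phi> \<Otimes>\<^sub>M distr (distr M T B) T' \<psi> =
      distr (distr M S A \<Otimes>\<^sub>M distr M T B) (S' \<Otimes>\<^sub>M T') (\<lambda>(x, y). (\<phi> x, \<psi> y))"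
    by (intro pair_measure_distr) (simp_all add: prob_space_imp_sigma_finite)
  also have "distr M S A \<Otimes>\<^sub>M distr M T B = distr M (S \<Otimes>\<^sub>M T) (\<lambda>x. (A x, B x))"
    using ind by (simp add: indep_rv_def)
  finally show ?thesis
    by (simp add: indep_rv_def distr_distr comp_def)
qed

text \<open>Reading \<open>A\<close> and \<open>B\<close> from two separate copies of
  \<open>M\<close> gives the same joint law as reading both from \<open>M\<close>. Fubini arguments
  on the product thereby transfer to independent variables on one space.\<close>

lemma (in prob_space) distr_pair_indep:
  assumes "indep_rv M S A T B"
  shows "distr (M \<Otimes>\<^sub>M M) (S \<Otimes>\<^sub>M T) (\<lambda>w. (A (fst w), B (snd w))) = distr M (S \<Otimes>\<^sub>M T) (\<lambda>x. (A x, B x))"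
proof -
  have AB [measurable]: "A \<in> measurable M S" "B \<in> measurable M T"
    using assms by (auto dest: indep_rvD)
  interpret B: prob_space "distr M T B" by (rule prob_space_distr) fact
  have "distr M S A \<Otimes>\<^sub>M distr M T B = distr (M \<Otimes>\<^sub>M M) (S \<Otimes>\<^sub>M T) (\<lambda>(x, y). (A x, B y))"
    by (rule pair_measure_distr) (auto intro: B.sigma_finite_measure_axioms)
  then show ?thesis
    using assms by (simp add: indep_rv_def case_prod_unfold)
qed

lemma (in prob_space)
  assumes "indep_rv M S A T B" and F: "F \<in> borel_measurable (S \<Otimes>\<^sub>M T)"
  shows integral_pair_indep: "(\<integral>w. F (A (fst w), B (snd w)) \<partial>(M \<Otimes>\<^sub>M M)) = (\<integral>x. F (A x, B x) \<partial>M)"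
    and sqint_pair_indep: "sqint (M \<Otimes>\<^sub>M M) (\<lambda>w. F (A (fst w), B (snd w))) \<longleftrightarrow> sqint M (\<lambda>x. F (A x, B x))"
    and nrm_pair_indep: "nrm (M \<Otimes>\<^sub>M M) (\<lambda>w. F (A (fst w), B (snd w))) = nrm M (\<lambda>x. F (A x, B x))"
proof -
  have [measurable]: "A \<in> measurable M S" "B \<in> measurable M T"
    using assms by (auto dest: indep_rvD)
  have m: "(\<lambda>w. (A (fst w), B (snd w))) \<in> measurable (M \<Otimes>\<^sub>M M) (S \<Otimes>\<^sub>M T)"
    "(\<lambda>x. (A x, B x)) \<in> measurable M (S \<Otimes>\<^sub>M T)" by measurable
  note eq = distr_pair_indep[OF assms(1)]
  show "(\<integral>w. F (A (fst w), B (snd w)) \<partial>(M \<Otimes>\<^sub>M M)) = (\<integral>x. F (A x, B x) \<partial>M)"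
    using integral_distr[OF m(1) F] integral_distr[OF m(2) F] eq by simp
  show "sqint (M \<Otimes>\<^sub>M M) (\<lambda>w. F (A (fst w), B (snd w))) \<longleftrightarrow> sqint M (\<lambda>x. F (A x, B x))"
    using sqint_distr_iff[OF m(1) F] sqint_distr_iff[OF m(2) F] eq by simp
  show "nrm (M \<Otimes>\<^sub>M M) (\<lambda>w. F (A (fst w), B (snd w))) = nrm M (\<lambda>x. F (A x, B x))"
    using nrm_distr[OF m(1) F] nrm_distr[OF m(2) F] eq by simp
qed

section \<open>The first-order part\<close>

definition centered_L2 :: "'a measure \<Rightarrow> 'b measure \<Rightarrow> ('a \<Rightarrow> 'b) \<Rightarrow> ('a \<Rightarrow> real) set" where
  "centered_L2 M N X =
    {(\<lambda>\<omega>. p (X \<omega>)) | p. p \<in> borel_measurable N \<and> sqint M (\<lambda>\<omega>. p (X \<omega>)) \<and> (\<integral>\<omega>. p (X \<omega>) \<partial>M) = 0}"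

lemma centered_L2I:
  "p \<in> borel_measurable N \<Longrightarrow> sqint M (\<lambda>\<omega>. p (X \<omega>)) \<Longrightarrow> (\<integral>\<omega>. p (X \<omega>) \<partial>M) = 0 \<Longrightarrow>
    (\<lambda>\<omega>. p (X \<omega>)) \<in> centered_L2 M N X"
  by (auto simp: centered_L2_def)

lemma centered_L2_sqint: "u \<in> centered_L2 M N X \<Longrightarrow> sqint M u"
  and centered_L2_integral: "u \<in> centered_L2 M N X \<Longrightarrow> (\<integral>\<omega>. u \<omega> \<partial>M) = 0"
  by (auto simp: centered_L2_def)

lemma centered_L2_comp:
  assumes "u \<in> centered_L2 M N X" "\<theta> \<in> measurable P N" "\<And>\<omega>. X \<omega> = \<theta> (Z \<omega>)"
  shows "u \<in> centered_L2 M P Z"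
proof -
  obtain p where p: "u = (\<lambda>\<omega>. p (X \<omega>))" "p \<in> borel_measurable N" "sqint M u" "(\<integral>\<omega>. u \<omega> \<partial>M) = 0"
    using assms(1) by (auto simp: centered_L2_def)
  have "u = (\<lambda>\<omega>. p (\<theta> (Z \<omega>)))"
    using p(1) assms(3) by simp
  then show ?thesis
    using p(3,4) measurable_compose[OF assms(2) p(2)] by (auto intro!: centered_L2I[of "\<lambda>z. p (\<theta> z)"])
qed

text \<open>
  The induction invariant. The orthogonality conditions make \<open>u\<close> and \<open>v\<close> behave like the projections
  of \<open>g\<close> and \<open>h\<close> to the first-order parts \<open>U\<close> and \<open>V\<close>, without showing that \<open>U\<close> and \<open>V\<close> are
  closed.
\<close>

definition split_bound ::
  "'a measure \<Rightarrow> 'b measure \<Rightarrow> ('a \<Rightarrow> 'b) \<Rightarrow> ('a \<Rightarrow> real) set \<Rightarrow>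
    'c measure \<Rightarrow> ('a \<Rightarrow> 'c) \<Rightarrow> ('a \<Rightarrow> real) set \<Rightarrow> real \<Rightarrow> bool" where
  "split_bound M N X U N' Y V \<rho> \<longleftrightarrow>
    (\<forall>g\<in>centered_L2 M N X. \<forall>h\<in>centered_L2 M N' Y. \<exists>u\<in>U. \<exists>v\<in>V.
      (\<integral>\<omega>. (g \<omega> - u \<omega>) * u \<omega> \<partial>M) = 0 \<and> (\<integral>\<omega>. (h \<omega> - v \<omega>) * v \<omega> \<partial>M) = 0 \<and>
      (\<integral>\<omega>. g \<omega> * h \<omega> \<partial>M) \<le> \<rho> * (nrm M u * nrm M v) +
        \<rho>\<^sup>2 * (nrm M (\<lambda>\<omega>. g \<omega> - u \<omega>) * nrm M (\<lambda>\<omega>. h \<omega> - v \<omega>)))"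

text \<open>Cauchy--Schwarz for the plane vectors \<open>(a, c)\<close> and \<open>(b, d)\<close> of
  lengths \<open>s\<close> and \<open>t\<close>, from the Lagrange identity with the square of
  \<open>a d - b c\<close>.\<close>

lemma Cauchy_Schwarz_2:
  fixes a b c d s t :: real
  assumes "s\<^sup>2 = a\<^sup>2 + c\<^sup>2" "t\<^sup>2 = b\<^sup>2 + d\<^sup>2" "0 \<le> s" "0 \<le> t"
  shows "a * b + c * d \<le> s * t"
proof (rule power2_le_imp_le)
  have "(s * t)\<^sup>2 - (a * b + c * d)\<^sup>2 = (a * d - b * c)\<^sup>2"
    unfolding power_mult_distrib assms(1,2) by (simp add: power2_eq_square algebra_simps)
  then show "(a * b + c * d)\<^sup>2 \<le> (s * t)\<^sup>2"
    by (smt (verit) zero_le_power2)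
qed (use assms in simp)

lemma nrm_split:
  assumes "sqint M g" "sqint M u" "(\<integral>\<omega>. (g \<omega> - u \<omega>) * u \<omega> \<partial>M) = 0"
  shows "(nrm M g)\<^sup>2 = (nrm M u)\<^sup>2 + (nrm M (\<lambda>\<omega>. g \<omega> - u \<omega>))\<^sup>2"
  using nrm_add_power2[OF assms(2) sqint_diff[OF assms(1,2)]] assms(3)
  by (simp add: mult.commute)

text \<open>As \<open>\<rho>^2 \<le> \<rho>\<close>, both terms carry the factor
  \<open>\<rho>\<close>; Pythagoras and planar Cauchy--Schwarz restore the full norms. The induction
  thus gets the maximal correlation of the block already treated.\<close>

lemma (in prob_space) split_bound_imp_maxcorr_le:
  assumes sb: "split_bound M N X U N' Y V \<rho>" and \<rho>: "0 \<le> \<rho>" "\<rho> \<le> 1"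
    and U: "\<And>u. u \<in> U \<Longrightarrow> sqint M u" and V: "\<And>v. v \<in> V \<Longrightarrow> sqint M v"
  shows "maxcorr_le M N X N' Y \<rho>"
proof (rule maxcorr_leI[OF \<rho>(1)])
  fix g h assume gm: "g \<in> borel_measurable N" and hm: "h \<in> borel_measurable N'"
    and g: "sqint M (\<lambda>x. g (X x))" and h: "sqint M (\<lambda>x. h (Y x))"
    and 0: "expectation (\<lambda>x. g (X x)) = 0" "expectation (\<lambda>x. h (Y x)) = 0"
  let ?g = "\<lambda>\<omega>. g (X \<omega>)" and ?h = "\<lambda>\<omega>. h (Y \<omega>)"
  obtain u v where uv: "u \<in> U" "v \<in> V"
      "(\<integral>\<omega>. (?g \<omega> - u \<omega>) * u \<omega> \<partial>M) = 0" "(\<integral>\<omega>. (?h \<omega> - v \<omega>) * v \<omega> \<partial>M) = 0"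
      "(\<integral>\<omega>. ?g \<omega> * ?h \<omega> \<partial>M) \<le> \<rho> * (nrm M u * nrm M v) +
        \<rho>\<^sup>2 * (nrm M (\<lambda>\<omega>. ?g \<omega> - u \<omega>) * nrm M (\<lambda>\<omega>. ?h \<omega> - v \<omega>))"
    using sb[unfolded split_bound_def, rule_format, OF centered_L2I[OF gm g 0(1)] centered_L2I[OF hm h 0(2)]]
    by blast
  note uv(5)
  also have "\<rho>\<^sup>2 * (nrm M (\<lambda>\<omega>. ?g \<omega> - u \<omega>) * nrm M (\<lambda>\<omega>. ?h \<omega> - v \<omega>))
      \<le> \<rho> * (nrm M (\<lambda>\<omega>. ?g \<omega> - u \<omega>) * nrm M (\<lambda>\<omega>. ?h \<omega> - v \<omega>))"
    using \<rho> by (intro mult_right_mono) (auto simp: power2_eq_square mult_left_le_one_le)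
  also have "\<rho> * (nrm M u * nrm M v) + \<rho> * (nrm M (\<lambda>\<omega>. ?g \<omega> - u \<omega>) * nrm M (\<lambda>\<omega>. ?h \<omega> - v \<omega>))
     = \<rho> * (nrm M u * nrm M v + nrm M (\<lambda>\<omega>. ?g \<omega> - u \<omega>) * nrm M (\<lambda>\<omega>. ?h \<omega> - v \<omega>))"
    by (simp add: distrib_left)
  also have "\<dots> \<le> \<rho> * (nrm M ?g * nrm M ?h)"
    using nrm_split[OF g U[OF uv(1)] uv(3)] nrm_split[OF h V[OF uv(2)] uv(4)] \<rho>
    by (intro mult_left_mono Cauchy_Schwarz_2) auto
  finally show "expectation (\<lambda>x. g (X x) * h (Y x)) \<le> \<rho> * (nrm M (\<lambda>x. g (X x)) * nrm M (\<lambda>x. h (Y x)))"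
    by simp
qed

text \<open>Functions of \<open>Z\<close> are functions of \<open>X\<close>, and larger
  \<open>U'\<close>, \<open>V'\<close> only offer more witnesses. This permits repackaging the
  coordinates after each step.\<close>

lemma split_bound_compose:
  assumes sb: "split_bound M N X U N' Y V \<rho>"
    and \<theta>: "\<theta> \<in> measurable N P" "\<And>\<omega>. Z \<omega> = \<theta> (X \<omega>)"
    and \<theta>': "\<theta>' \<in> measurable N' P'" "\<And>\<omega>. Z' \<omega> = \<theta>' (Y \<omega>)"
    and UV: "U \<subseteq> U'" "V \<subseteq> V'"
  shows "split_bound M P Z U' P' Z' V' \<rho>"
  unfolding split_bound_def
proof (intro ballI)
  fix g h assume "g \<in> centered_L2 M P Z" "h \<in> centered_L2 M P' Z'"
  then have "g \<in> centered_L2 M N X" "h \<in> centered_L2 M N' Y"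
    using centered_L2_comp[where X=Z and \<theta>=\<theta> and Z=X] \<theta>
      centered_L2_comp[where X=Z' and \<theta>=\<theta>' and Z=Y] \<theta>' by simp_all
  then show "\<exists>u\<in>U'. \<exists>v\<in>V'. (\<integral>\<omega>. (g \<omega> - u \<omega>) * u \<omega> \<partial>M) = 0 \<and> (\<integral>\<omega>. (h \<omega> - v \<omega>) * v \<omega> \<partial>M) = 0 \<and>
      (\<integral>\<omega>. g \<omega> * h \<omega> \<partial>M) \<le> \<rho> * (nrm M u * nrm M v) +
        \<rho>\<^sup>2 * (nrm M (\<lambda>\<omega>. g \<omega> - u \<omega>) * nrm M (\<lambda>\<omega>. h \<omega> - v \<omega>))"
    using sb UV unfolding split_bound_def by (meson subsetD)
qed

context prob_space
begin

text \<open>Both claims move to the product of two copies of \<open>M\<close>, where a vanishing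
  marginal gives orthogonality by Fubini.\<close>

lemma expectation_mult_indep_eq_0:
  assumes ind: "indep_rv M S A T B" and F [measurable]: "F \<in> borel_measurable (S \<Otimes>\<^sub>M T)"
    and sq: "sqint M (\<lambda>\<omega>. F (A \<omega>, B \<omega>))"
  shows "(AE x in M. expectation (\<lambda>y. F (A x, B y)) = 0) \<Longrightarrow> p \<in> centered_L2 M S A \<Longrightarrow>
      expectation (\<lambda>\<omega>. F (A \<omega>, B \<omega>) * p \<omega>) = 0"
    and "(AE y in M. expectation (\<lambda>x. F (A x, B y)) = 0) \<Longrightarrow> q \<in> centered_L2 M T B \<Longrightarrow>
      expectation (\<lambda>\<omega>. F (A \<omega>, B \<omega>) * q \<omega>) = 0"
proof -
  interpret Q: pair_prob_space M M ..
  have U: "sqint (M \<Otimes>\<^sub>M M) (\<lambda>w. F (A (fst w), B (snd w)))"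
    using sqint_pair_indep[OF ind F] sq by simp
  {
    assume z: "AE x in M. expectation (\<lambda>y. F (A x, B y)) = 0" and p: "p \<in> centered_L2 M S A"
    then obtain p' where p': "p = (\<lambda>\<omega>. p' (A \<omega>))" and [measurable]: "p' \<in> borel_measurable S"
      by (auto simp: centered_L2_def)
    have "(\<lambda>z. F z * p' (fst z)) \<in> borel_measurable (S \<Otimes>\<^sub>M T)" by measurable
    from integral_pair_indep[OF ind this] Q.integral_mult_fst_eq_0[OF U centered_L2_sqint[OF p]] z
    show "expectation (\<lambda>\<omega>. F (A \<omega>, B \<omega>) * p \<omega>) = 0"
      by (simp add: p')
  }
  {
    assume z: "AE y in M. expectation (\<lambda>x. F (A x, B y)) = 0" and q: "q \<in> centered_L2 M T B"
    then obtain q' where q': "q = (\<lambda>\<omega>. q' (B \<omega>))" and [measurable]: "q' \<in> borel_measurable T"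
      by (auto simp: centered_L2_def)
    have "(\<lambda>z. F z * q' (snd z)) \<in> borel_measurable (S \<Otimes>\<^sub>M T)" by measurable
    from integral_pair_indep[OF ind this] Q.integral_mult_snd_eq_0[OF U centered_L2_sqint[OF q]] z
    show "expectation (\<lambda>\<omega>. F (A \<omega>, B \<omega>) * q \<omega>) = 0"
      by (simp add: q')
  }
qed

lemma expectation_mult_indep:
  assumes ind: "indep_rv M S A T B" and p: "p \<in> centered_L2 M S A" and q: "q \<in> centered_L2 M T B"
  shows "expectation (\<lambda>\<omega>. p \<omega> * q \<omega>) = 0"
proof -
  obtain p' where p': "p = (\<lambda>\<omega>. p' (A \<omega>))" and [measurable]: "p' \<in> borel_measurable S"
    using p by (auto simp: centered_L2_def)
  have "expectation (\<lambda>\<omega>. p' (fst (A \<omega>, B \<omega>)) * q \<omega>) = 0"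
    using centered_L2_sqint[OF p] centered_L2_integral[OF p] q
    by (intro expectation_mult_indep_eq_0(2)[OF ind, of "\<lambda>z. p' (fst z)"]) (auto simp: p')
  then show ?thesis by (simp add: p')
qed

text \<open>The Hoeffding decomposition for two independent blocks: the marginals are the terms of
  one block each, and both marginals of the remainder vanish. As the mean is 0, there is no constant
  term.\<close>

lemma marginals_indep:
  assumes ind: "indep_rv M S A T B" and F [measurable]: "F \<in> borel_measurable (S \<Otimes>\<^sub>M T)"
    and sq: "sqint M (\<lambda>\<omega>. F (A \<omega>, B \<omega>))" and F0: "expectation (\<lambda>\<omega>. F (A \<omega>, B \<omega>)) = 0"
  defines "FA \<equiv> \<lambda>s. expectation (\<lambda>y. F (s, B y))" and "FB \<equiv> \<lambda>t. expectation (\<lambda>x. F (A x, t))"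
  shows "(\<lambda>\<omega>. FA (A \<omega>)) \<in> centered_L2 M S A" "(\<lambda>\<omega>. FB (B \<omega>)) \<in> centered_L2 M T B"
    "AE x in M. expectation (\<lambda>y. F (A x, B y) - FA (A x) - FB (B y)) = 0"
    "AE y in M. expectation (\<lambda>x. F (A x, B y) - FA (A x) - FB (B y)) = 0"
proof -
  interpret Q: pair_prob_space M M ..
  have [measurable]: "A \<in> measurable M S" "B \<in> measurable M T"
    using ind by (auto dest: indep_rvD)
  let ?u = "\<lambda>w. F (A (fst w), B (snd w))"
  have U: "sqint (M \<Otimes>\<^sub>M M) ?u"
    using sqint_pair_indep[OF ind F] sq by simp
  have U0: "Q.expectation ?u = 0"
    using integral_pair_indep[OF ind F] F0 by simp
  have Ui: "integrable (M \<Otimes>\<^sub>M M) ?u" by (rule Q.integrable_sqint[OF U])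
  show "(\<lambda>\<omega>. FA (A \<omega>)) \<in> centered_L2 M S A"
    using Q.sqint_integral_snd[OF U] Q.integral_fst'[OF Ui] U0
    by (intro centered_L2I) (simp_all add: FA_def)
  show "(\<lambda>\<omega>. FB (B \<omega>)) \<in> centered_L2 M T B"
    using Q.sqint_integral_fst[OF U] Q.integral_snd[of "\<lambda>x y. ?u (x, y)"] Ui U0
    by (intro centered_L2I) (simp_all add: FB_def case_prod_unfold)
  show "AE x in M. expectation (\<lambda>y. F (A x, B y) - FA (A x) - FB (B y)) = 0"
    using Q.AE_integral_remainder_snd[OF U U0] by (simp add: FA_def FB_def)
  show "AE y in M. expectation (\<lambda>x. F (A x, B y) - FA (A x) - FB (B y)) = 0"
    using Q.AE_integral_remainder_fst[OF U U0] by (simp add: FA_def FB_def)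
qed

text \<open>The induction step. Decompose \<open>g = a + b + r\<close> and
  \<open>h = a' + b' + r'\<close> into old block, new coordinate and interaction. Only
  \<open>a a'\<close>, \<open>b b'\<close> and \<open>r r'\<close> have nonzero expectation; they
  are bounded by the old split, by \<open>\<rho>\<close>, and by the tensor bound with
  \<open>\<rho>^2\<close>. The new first-order parts are \<open>u + b\<close> and
  \<open>v + b'\<close>.\<close>

lemma split_bound_pair:
  assumes ind: "indep_rv M (NA \<Otimes>\<^sub>M NA') (\<lambda>\<omega>. (XA \<omega>, YA \<omega>)) (NB \<Otimes>\<^sub>M NB') (\<lambda>\<omega>. (XB \<omega>, YB \<omega>))"
    and \<rho>: "0 \<le> \<rho>" "\<rho> \<le> 1"
    and sb: "split_bound M NA XA UA NA' YA VA \<rho>"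
    and mcB: "maxcorr_le M NB XB NB' YB \<rho>"
    and UA: "UA \<subseteq> centered_L2 M NA XA" and VA: "VA \<subseteq> centered_L2 M NA' YA"
  shows "split_bound M (NA \<Otimes>\<^sub>M NB) (\<lambda>\<omega>. (XA \<omega>, XB \<omega>))
      {(\<lambda>\<omega>. u \<omega> + b \<omega>) | u b. u \<in> UA \<and> b \<in> centered_L2 M NB XB}
      (NA' \<Otimes>\<^sub>M NB') (\<lambda>\<omega>. (YA \<omega>, YB \<omega>))
      {(\<lambda>\<omega>. v \<omega> + b \<omega>) | v b. v \<in> VA \<and> b \<in> centered_L2 M NB' YB} \<rho>"
  unfolding split_bound_def
proof (intro ballI)
  fix gg hh
  assume gg: "gg \<in> centered_L2 M (NA \<Otimes>\<^sub>M NB) (\<lambda>\<omega>. (XA \<omega>, XB \<omega>))"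
    and hh: "hh \<in> centered_L2 M (NA' \<Otimes>\<^sub>M NB') (\<lambda>\<omega>. (YA \<omega>, YB \<omega>))"
  interpret Q: pair_prob_space M M ..
  have "(\<lambda>\<omega>. fst (XA \<omega>, YA \<omega>)) \<in> measurable M NA" "(\<lambda>\<omega>. snd (XA \<omega>, YA \<omega>)) \<in> measurable M NA'"
    "(\<lambda>\<omega>. fst (XB \<omega>, YB \<omega>)) \<in> measurable M NB" "(\<lambda>\<omega>. snd (XB \<omega>, YB \<omega>)) \<in> measurable M NB'"
    by (rule measurable_compose[OF indep_rvD(1)[OF ind] measurable_fst]
        measurable_compose[OF indep_rvD(1)[OF ind] measurable_snd]
        measurable_compose[OF indep_rvD(2)[OF ind] measurable_fst]
        measurable_compose[OF indep_rvD(2)[OF ind] measurable_snd])+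
  then have mXY [measurable]: "XA \<in> measurable M NA" "YA \<in> measurable M NA'"
    "XB \<in> measurable M NB" "YB \<in> measurable M NB'" by simp_all
  let ?A = "\<lambda>\<omega>. (XA \<omega>, YA \<omega>)" and ?B = "\<lambda>\<omega>. (XB \<omega>, YB \<omega>)"
  obtain g where gm [measurable]: "g \<in> borel_measurable (NA \<Otimes>\<^sub>M NB)" and gg_eq: "gg = (\<lambda>\<omega>. g (XA \<omega>, XB \<omega>))"
    using gg by (auto simp: centered_L2_def)
  obtain h where hm [measurable]: "h \<in> borel_measurable (NA' \<Otimes>\<^sub>M NB')" and hh_eq: "hh = (\<lambda>\<omega>. h (YA \<omega>, YB \<omega>))"
    using hh by (auto simp: centered_L2_def)
  have gg_sq: "sqint M gg" and hh_sq: "sqint M hh"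
    using gg hh by (simp_all add: centered_L2_sqint)

  define gA where "gA s = expectation (\<lambda>y. g (s, XB y))" for s
  define gB where "gB t = expectation (\<lambda>x. g (XA x, t))" for t
  define hA where "hA s = expectation (\<lambda>y. h (s, YB y))" for s
  define hB where "hB t = expectation (\<lambda>x. h (YA x, t))" for t
  have [measurable]: "gA \<in> borel_measurable NA" "gB \<in> borel_measurable NB"
    "hA \<in> borel_measurable NA'" "hB \<in> borel_measurable NB'"
    unfolding gA_def gB_def hA_def hB_def by measurable
  define gR where "gR z = g z - gA (fst z) - gB (snd z)" for z
  define hR where "hR z = h z - hA (fst z) - hB (snd z)" for z
  have gRm [measurable]: "gR \<in> borel_measurable (NA \<Otimes>\<^sub>M NB)" and hRm [measurable]: "hR \<in> borel_measurable (NA' \<Otimes>\<^sub>M NB')"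
    unfolding gR_def hR_def by measurable
  \<comment> \<open>Independence concerns the pairs \<open>(XA, YA)\<close> and
    \<open>(XB, YB)\<close>, so \<open>g\<close> and \<open>h\<close> are lifted to functions of
    these pairs before taking marginals.\<close>
  let ?Fg = "\<lambda>z. g (fst (fst z), fst (snd z))" and ?Fh = "\<lambda>z. h (snd (fst z), snd (snd z))"
  have Fm: "?Fg \<in> borel_measurable ((NA \<Otimes>\<^sub>M NA') \<Otimes>\<^sub>M (NB \<Otimes>\<^sub>M NB'))"
    "?Fh \<in> borel_measurable ((NA \<Otimes>\<^sub>M NA') \<Otimes>\<^sub>M (NB \<Otimes>\<^sub>M NB'))" by measurable
  note mg = marginals_indep[OF ind Fm(1), simplified, folded gA_def gB_def]
  note mh = marginals_indep[OF ind Fm(2), simplified, folded hA_def hB_def]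
  have gAE: "AE x in M. expectation (\<lambda>y. gR (XA x, XB y)) = 0" "AE y in M. expectation (\<lambda>x. gR (XA x, XB y)) = 0"
    and ga0: "(\<lambda>\<omega>. gA (XA \<omega>)) \<in> centered_L2 M (NA \<Otimes>\<^sub>M NA') ?A"
    and gb0: "(\<lambda>\<omega>. gB (XB \<omega>)) \<in> centered_L2 M (NB \<Otimes>\<^sub>M NB') ?B"
    using mg gg centered_L2_sqint[OF gg] centered_L2_integral[OF gg] by (simp_all add: gR_def gg_eq)
  have hAE: "AE x in M. expectation (\<lambda>y. hR (YA x, YB y)) = 0" "AE y in M. expectation (\<lambda>x. hR (YA x, YB y)) = 0"
    and ha0: "(\<lambda>\<omega>. hA (YA \<omega>)) \<in> centered_L2 M (NA \<Otimes>\<^sub>M NA') ?A"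
    and hb0: "(\<lambda>\<omega>. hB (YB \<omega>)) \<in> centered_L2 M (NB \<Otimes>\<^sub>M NB') ?B"
    using mh hh centered_L2_sqint[OF hh] centered_L2_integral[OF hh] by (simp_all add: hR_def hh_eq)
  have gA: "(\<lambda>\<omega>. gA (XA \<omega>)) \<in> centered_L2 M NA XA" and gB: "(\<lambda>\<omega>. gB (XB \<omega>)) \<in> centered_L2 M NB XB"
    and hA: "(\<lambda>\<omega>. hA (YA \<omega>)) \<in> centered_L2 M NA' YA" and hB: "(\<lambda>\<omega>. hB (YB \<omega>)) \<in> centered_L2 M NB' YB"
    using ga0 gb0 ha0 hb0 by (auto intro!: centered_L2I dest: centered_L2_sqint centered_L2_integral)

  define a where "a \<omega> = gA (XA \<omega>)" for \<omega>
  define b where "b \<omega> = gB (XB \<omega>)" for \<omega>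
  define r where "r \<omega> = gR (XA \<omega>, XB \<omega>)" for \<omega>
  define a' where "a' \<omega> = hA (YA \<omega>)" for \<omega>
  define b' where "b' \<omega> = hB (YB \<omega>)" for \<omega>
  define r' where "r' \<omega> = hR (YA \<omega>, YB \<omega>)" for \<omega>
  have g_dec: "gg \<omega> = a \<omega> + (b \<omega> + r \<omega>)" and h_dec: "hh \<omega> = a' \<omega> + (b' \<omega> + r' \<omega>)" for \<omega>
    by (simp_all add: gg_eq hh_eq a_def b_def r_def a'_def b'_def r'_def gR_def hR_def)
  have ac: "a \<in> centered_L2 M NA XA" and bc: "b \<in> centered_L2 M NB XB"
    and a'c: "a' \<in> centered_L2 M NA' YA" and b'c: "b' \<in> centered_L2 M NB' YB"
    using gA gB hA hB unfolding a_def b_def a'_def b'_def .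
  obtain u v where u: "u \<in> UA" and v: "v \<in> VA"
    and uo: "expectation (\<lambda>\<omega>. (a \<omega> - u \<omega>) * u \<omega>) = 0" and vo: "expectation (\<lambda>\<omega>. (a' \<omega> - v \<omega>) * v \<omega>) = 0"
    and uv: "expectation (\<lambda>\<omega>. a \<omega> * a' \<omega>) \<le> \<rho> * (nrm M u * nrm M v) +
        \<rho>\<^sup>2 * (nrm M (\<lambda>\<omega>. a \<omega> - u \<omega>) * nrm M (\<lambda>\<omega>. a' \<omega> - v \<omega>))"
    using sb[unfolded split_bound_def, rule_format, OF ac a'c] by blast
  \<comment> \<open>With every term viewed as a function of the pair in its block, mixed products
    such as \<open>a b'\<close> also fall under the orthogonality of independent blocks.\<close>
  have XAA: "w \<in> centered_L2 M (NA \<Otimes>\<^sub>M NA') ?A" if "w \<in> centered_L2 M NA XA" for w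
    by (rule centered_L2_comp[OF that measurable_fst]) simp
  have YAA: "w \<in> centered_L2 M (NA \<Otimes>\<^sub>M NA') ?A" if "w \<in> centered_L2 M NA' YA" for w
    by (rule centered_L2_comp[OF that measurable_snd]) simp
  have XBB: "w \<in> centered_L2 M (NB \<Otimes>\<^sub>M NB') ?B" if "w \<in> centered_L2 M NB XB" for w
    by (rule centered_L2_comp[OF that measurable_fst]) simp
  have YBB: "w \<in> centered_L2 M (NB \<Otimes>\<^sub>M NB') ?B" if "w \<in> centered_L2 M NB' YB" for w
    by (rule centered_L2_comp[OF that measurable_snd]) simp
  have uc: "u \<in> centered_L2 M NA XA" and vc: "v \<in> centered_L2 M NA' YA"
    using u v UA VA by auto
  note cA = XAA[OF ac] XAA[OF uc] YAA[OF a'c] YAA[OF vc]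
  note cB = XBB[OF bc] YBB[OF b'c]
  have r_sq: "sqint M r"
    unfolding r_def gR_def
    using sqint_diff[OF sqint_diff[OF gg_sq centered_L2_sqint[OF ac]] centered_L2_sqint[OF bc]]
    by (simp add: gg_eq a_def b_def)
  have r'_sq: "sqint M r'"
    unfolding r'_def hR_def
    using sqint_diff[OF sqint_diff[OF hh_sq centered_L2_sqint[OF a'c]] centered_L2_sqint[OF b'c]]
    by (simp add: hh_eq a'_def b'_def)
  note sq = r_sq r'_sq cA[THEN centered_L2_sqint] cB[THEN centered_L2_sqint]
  have AB: "expectation (\<lambda>\<omega>. p \<omega> * q \<omega>) = 0" "expectation (\<lambda>\<omega>. q \<omega> * p \<omega>) = 0"
    if "p \<in> centered_L2 M (NA \<Otimes>\<^sub>M NA') ?A" "q \<in> centered_L2 M (NB \<Otimes>\<^sub>M NB') ?B" for p q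
    using expectation_mult_indep[OF ind that] by (simp_all add: mult.commute)
  have FRm: "(\<lambda>z. gR (fst (fst z), fst (snd z))) \<in> borel_measurable ((NA \<Otimes>\<^sub>M NA') \<Otimes>\<^sub>M (NB \<Otimes>\<^sub>M NB'))"
    "(\<lambda>z. hR (snd (fst z), snd (snd z))) \<in> borel_measurable ((NA \<Otimes>\<^sub>M NA') \<Otimes>\<^sub>M (NB \<Otimes>\<^sub>M NB'))"
    by measurable
  have rA: "expectation (\<lambda>\<omega>. r \<omega> * p \<omega>) = 0" "expectation (\<lambda>\<omega>. p \<omega> * r \<omega>) = 0"
       "expectation (\<lambda>\<omega>. r' \<omega> * p \<omega>) = 0" "expectation (\<lambda>\<omega>. p \<omega> * r' \<omega>) = 0"
    if "p \<in> centered_L2 M (NA \<Otimes>\<^sub>M NA') ?A" for p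
    using expectation_mult_indep_eq_0(1)[OF ind FRm(1) _ _ that] expectation_mult_indep_eq_0(1)[OF ind FRm(2) _ _ that]
      gAE hAE r_sq r'_sq unfolding r_def r'_def by (simp_all add: mult.commute)
  have rB: "expectation (\<lambda>\<omega>. r \<omega> * q \<omega>) = 0" "expectation (\<lambda>\<omega>. q \<omega> * r \<omega>) = 0"
       "expectation (\<lambda>\<omega>. r' \<omega> * q \<omega>) = 0" "expectation (\<lambda>\<omega>. q \<omega> * r' \<omega>) = 0"
    if "q \<in> centered_L2 M (NB \<Otimes>\<^sub>M NB') ?B" for q
    using expectation_mult_indep_eq_0(2)[OF ind FRm(1) _ _ that] expectation_mult_indep_eq_0(2)[OF ind FRm(2) _ _ that]
      gAE hAE r_sq r'_sq unfolding r_def r'_def by (simp_all add: mult.commute)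
  note orth = AB[OF cA(1) cB(1)] AB[OF cA(1) cB(2)] AB[OF cA(2) cB(1)] AB[OF cA(2) cB(2)]
    AB[OF cA(3) cB(1)] AB[OF cA(3) cB(2)] AB[OF cA(4) cB(1)] AB[OF cA(4) cB(2)]
    rA[OF cA(1)] rA[OF cA(2)] rA[OF cA(3)] rA[OF cA(4)] rB[OF cB(1)] rB[OF cB(2)]
  have GH: "expectation (\<lambda>\<omega>. gg \<omega> * hh \<omega>) =
     expectation (\<lambda>\<omega>. a \<omega> * a' \<omega>) + expectation (\<lambda>\<omega>. b \<omega> * b' \<omega>) + expectation (\<lambda>\<omega>. r \<omega> * r' \<omega>)"
    unfolding g_dec h_dec using sq by (simp add: integral_add_mult sqint_add orth)
  have bb: "expectation (\<lambda>\<omega>. b \<omega> * b' \<omega>) \<le> \<rho> * (nrm M b * nrm M b')"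
    unfolding b_def b'_def using gB hB
    by (intro maxcorr_leD[OF mcB]) (auto dest: centered_L2_sqint centered_L2_integral)
  have rr: "expectation (\<lambda>\<omega>. r \<omega> * r' \<omega>) \<le> \<rho>\<^sup>2 * (nrm M r * nrm M r')"
  proof -
    \<comment> \<open>The tensor bound requires the maximal correlation of the old block, which the
      induction hypothesis contains.\<close>
    have mcA: "maxcorr_le M NA XA NA' YA \<rho>"
      using UA VA by (intro split_bound_imp_maxcorr_le[OF sb \<rho>]) (auto dest: centered_L2_sqint)
    have FR2: "(\<lambda>z. gR (fst (fst z), fst (snd z)) * hR (snd (fst z), snd (snd z))) \<in>
        borel_measurable ((NA \<Otimes>\<^sub>M NA') \<Otimes>\<^sub>M (NB \<Otimes>\<^sub>M NB'))" by measurable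
    note t = integral_pair_indep[OF ind FR2] sqint_pair_indep[OF ind FRm(1)] sqint_pair_indep[OF ind FRm(2)]
       nrm_pair_indep[OF ind FRm(1)] nrm_pair_indep[OF ind FRm(2)]
    show ?thesis
      using Q.integral_mult_le_tensor[OF mXY \<rho>(1) mcA mcB gRm hRm _ _ gAE(1) hAE(2)] t r_sq r'_sq
      unfolding r_def r'_def by simp
  qed
  let ?u = "\<lambda>\<omega>. u \<omega> + b \<omega>" and ?v = "\<lambda>\<omega>. v \<omega> + b' \<omega>"
  have du: "gg \<omega> - (u \<omega> + b \<omega>) = (a \<omega> - u \<omega>) + r \<omega>"
    and dv: "hh \<omega> - (v \<omega> + b' \<omega>) = (a' \<omega> - v \<omega>) + r' \<omega>" for \<omega>
    by (simp_all add: g_dec h_dec)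
  have 1: "expectation (\<lambda>\<omega>. (gg \<omega> - ?u \<omega>) * ?u \<omega>) = 0"
    unfolding du using sq uo by (simp add: integral_add_mult integral_diff_mult sqint_add sqint_diff orth)
  have 2: "expectation (\<lambda>\<omega>. (hh \<omega> - ?v \<omega>) * ?v \<omega>) = 0"
    unfolding dv using sq vo by (simp add: integral_add_mult integral_diff_mult sqint_add sqint_diff orth)
  have n: "(nrm M ?u)\<^sup>2 = (nrm M u)\<^sup>2 + (nrm M b)\<^sup>2" "(nrm M ?v)\<^sup>2 = (nrm M v)\<^sup>2 + (nrm M b')\<^sup>2"
    "(nrm M (\<lambda>\<omega>. (a \<omega> - u \<omega>) + r \<omega>))\<^sup>2 = (nrm M (\<lambda>\<omega>. a \<omega> - u \<omega>))\<^sup>2 + (nrm M r)\<^sup>2"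
    "(nrm M (\<lambda>\<omega>. (a' \<omega> - v \<omega>) + r' \<omega>))\<^sup>2 = (nrm M (\<lambda>\<omega>. a' \<omega> - v \<omega>))\<^sup>2 + (nrm M r')\<^sup>2"
    using sq by (simp_all add: nrm_add_power2 sqint_diff integral_diff_mult orth)
  have "expectation (\<lambda>\<omega>. gg \<omega> * hh \<omega>) \<le>
     \<rho> * (nrm M u * nrm M v + nrm M b * nrm M b') +
     \<rho>\<^sup>2 * (nrm M (\<lambda>\<omega>. a \<omega> - u \<omega>) * nrm M (\<lambda>\<omega>. a' \<omega> - v \<omega>) + nrm M r * nrm M r')"
    unfolding GH using uv bb rr by (simp add: distrib_left)
  \<comment> \<open>All four new norms split by Pythagoras, so planar Cauchy--Schwarz applies
    separately to the first-order norms and to the remainder norms.\<close>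
  also have "\<dots> \<le> \<rho> * (nrm M ?u * nrm M ?v) +
     \<rho>\<^sup>2 * (nrm M (\<lambda>\<omega>. gg \<omega> - ?u \<omega>) * nrm M (\<lambda>\<omega>. hh \<omega> - ?v \<omega>))"
    unfolding du dv using \<rho>(1) n by (intro add_mono mult_left_mono Cauchy_Schwarz_2) auto
  finally have 3: "expectation (\<lambda>\<omega>. gg \<omega> * hh \<omega>) \<le> \<rho> * (nrm M ?u * nrm M ?v) +
     \<rho>\<^sup>2 * (nrm M (\<lambda>\<omega>. gg \<omega> - ?u \<omega>) * nrm M (\<lambda>\<omega>. hh \<omega> - ?v \<omega>))" .
  show "\<exists>u\<in>{(\<lambda>\<omega>. u \<omega> + b \<omega>) | u b. u \<in> UA \<and> b \<in> centered_L2 M NB XB}.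
    \<exists>v\<in>{(\<lambda>\<omega>. v \<omega> + b \<omega>) | v b. v \<in> VA \<and> b \<in> centered_L2 M NB' YB}.
      expectation (\<lambda>\<omega>. (gg \<omega> - u \<omega>) * u \<omega>) = 0 \<and> expectation (\<lambda>\<omega>. (hh \<omega> - v \<omega>) * v \<omega>) = 0 \<and>
      expectation (\<lambda>\<omega>. gg \<omega> * hh \<omega>) \<le> \<rho> * (nrm M u * nrm M v) +
        \<rho>\<^sup>2 * (nrm M (\<lambda>\<omega>. gg \<omega> - u \<omega>) * nrm M (\<lambda>\<omega>. hh \<omega> - v \<omega>))"
    using u v bc b'c 1 2 3 by (intro bexI[of _ ?u] bexI[of _ ?v] conjI) auto
qed

end

section \<open>Induction over the coordinates\<close>

context prob_space
begin

lemma centered_L2_sum: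
  assumes "\<And>i. i \<in> I \<Longrightarrow> u i \<in> centered_L2 M N Z"
  shows "(\<lambda>\<omega>. \<Sum>i\<in>I. u i \<omega>) \<in> centered_L2 M N Z"
proof -
  have "\<exists>p. \<forall>i\<in>I. p i \<in> borel_measurable N \<and> u i = (\<lambda>\<omega>. p i (Z \<omega>))"
    using assms by (intro bchoice) (auto simp: centered_L2_def)
  then obtain p where p: "\<And>i. i \<in> I \<Longrightarrow> p i \<in> borel_measurable N" "\<And>i. i \<in> I \<Longrightarrow> u i = (\<lambda>\<omega>. p i (Z \<omega>))"
    by blast
  have eq: "(\<lambda>\<omega>. \<Sum>i\<in>I. u i \<omega>) = (\<lambda>\<omega>. \<Sum>i\<in>I. p i (Z \<omega>))"
    using p(2) by simp
  have 1: "(\<lambda>z. \<Sum>i\<in>I. p i z) \<in> borel_measurable N"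
    using p(1) by (intro borel_measurable_sum)
  have 2: "sqint M (\<lambda>\<omega>. \<Sum>i\<in>I. u i \<omega>)"
    using assms by (intro sqint_sum) (rule centered_L2_sqint)
  have 3: "expectation (\<lambda>\<omega>. \<Sum>i\<in>I. u i \<omega>) = 0"
  proof -
    have "expectation (\<lambda>\<omega>. \<Sum>i\<in>I. u i \<omega>) = (\<Sum>i\<in>I. expectation (u i))"
      using assms by (intro Bochner_Integration.integral_sum integrable_sqint) (rule centered_L2_sqint)
    then show ?thesis using centered_L2_integral[OF assms] by simp
  qed
  show ?thesis
    unfolding eq using 2 3 by (intro centered_L2I[OF 1]) (simp_all add: eq)
qed

lemma space_sum_centered_L2:
  "space_sum I (\<lambda>i. centered_L2 M (N i) (X i)) \<subseteq> centered_L2 M (PiM I N) (\<lambda>\<omega>. \<lambda>i\<in>I. X i \<omega>)"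
proof
  fix u assume "u \<in> space_sum I (\<lambda>i. centered_L2 M (N i) (X i))"
  then obtain w where w: "u = (\<lambda>\<omega>. \<Sum>i\<in>I. w i \<omega>)" "\<And>i. i \<in> I \<Longrightarrow> w i \<in> centered_L2 M (N i) (X i)"
    by (auto simp: space_sum_def)
  show "u \<in> centered_L2 M (PiM I N) (\<lambda>\<omega>. \<lambda>i\<in>I. X i \<omega>)"
    unfolding w(1)
  proof (rule centered_L2_sum)
    fix i assume i: "i \<in> I"
    show "w i \<in> centered_L2 M (PiM I N) (\<lambda>\<omega>. \<lambda>i\<in>I. X i \<omega>)"
      using i by (intro centered_L2_comp[OF w(2)[OF i], where \<theta>="\<lambda>x. x i"]) simp_all
  qed
qed

text \<open>Induction on \<open>I\<close>: the tuple over \<open>I\<close> and the new pair are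
  independent, so \<open>split_bound_pair\<close> applies, and gluing them yields the tuple over
  \<open>insert j I\<close>.\<close>

lemma split_bound_PiM:
  assumes "finite I"
    and "indep_vars (\<lambda>i. N i \<Otimes>\<^sub>M N' i) (\<lambda>i \<omega>. (X i \<omega>, Y i \<omega>)) I"
    and \<rho>: "0 \<le> \<rho>" "\<rho> \<le> 1"
    and "\<And>i. i \<in> I \<Longrightarrow> maxcorr_le M (N i) (X i) (N' i) (Y i) \<rho>"
  shows "split_bound M (PiM I N) (\<lambda>\<omega>. \<lambda>i\<in>I. X i \<omega>) (space_sum I (\<lambda>i. centered_L2 M (N i) (X i)))
    (PiM I N') (\<lambda>\<omega>. \<lambda>i\<in>I. Y i \<omega>) (space_sum I (\<lambda>i. centered_L2 M (N' i) (Y i))) \<rho>"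
  using assms(1,2,5)
proof (induction I rule: finite_induct)
  case empty
  \<comment> \<open>The empty tuple has a single value, so a function of it is constant, and
    centring makes this constant 0.\<close>
  have 0: "g = (\<lambda>_. 0)" if "g \<in> centered_L2 M P (\<lambda>\<omega>. \<lambda>i\<in>{}. Z i \<omega>)" for g and P :: "('i \<Rightarrow> 'z) measure" and Z
    using that by (auto simp: centered_L2_def restrict_def prob_space)
  show ?case
    unfolding split_bound_def space_sum_def by (auto dest!: 0 simp: nrm_def)
next
  case (insert j I)
  let ?P = "\<lambda>i. N i \<Otimes>\<^sub>M N' i" and ?Z = "\<lambda>i \<omega>. (X i \<omega>, Y i \<omega>)"
  let ?X = "\<lambda>\<omega>. \<lambda>i\<in>I. X i \<omega>" and ?Y = "\<lambda>\<omega>. \<lambda>i\<in>I. Y i \<omega>"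
  have sb: "split_bound M (PiM I N) ?X (space_sum I (\<lambda>i. centered_L2 M (N i) (X i)))
      (PiM I N') ?Y (space_sum I (\<lambda>i. centered_L2 M (N' i) (Y i))) \<rho>"
    using insert.prems by (intro insert.IH indep_vars_subset[OF insert.prems(1)]) auto
  have "indep_var (PiM I ?P) (\<lambda>\<omega>. restrict (\<lambda>i. ?Z i \<omega>) I) (PiM {j} ?P) (\<lambda>\<omega>. restrict (\<lambda>i. ?Z i \<omega>) {j})"
    using insert.hyps by (intro indep_var_restrict[OF insert.prems(1)]) auto
  then have ind0: "indep_rv M (PiM I ?P) (\<lambda>\<omega>. restrict (\<lambda>i. ?Z i \<omega>) I) (PiM {j} ?P) (\<lambda>\<omega>. restrict (\<lambda>i. ?Z i \<omega>) {j})"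
    unfolding indep_var_distribution_eq indep_rv_def .
  have comp: "(\<lambda>z. fst (z i)) \<in> measurable (PiM I ?P) (N i)" "(\<lambda>z. snd (z i)) \<in> measurable (PiM I ?P) (N' i)"
    if "i \<in> I" for i
    by (rule measurable_compose[OF measurable_component_singleton[OF that, of ?P] measurable_fst]
        measurable_compose[OF measurable_component_singleton[OF that, of ?P] measurable_snd])+
  \<comment> \<open>\<open>\<phi>\<close> unzips a tuple of pairs into a pair of tuples, the shape
    that \<open>split_bound_pair\<close> expects.\<close>
  have \<phi>: "(\<lambda>z. (\<lambda>i\<in>I. fst (z i), \<lambda>i\<in>I. snd (z i))) \<in> measurable (PiM I ?P) (PiM I N \<Otimes>\<^sub>M PiM I N')"
    by (intro measurable_Pair measurable_restrict comp)
  have \<psi>: "(\<lambda>z. z j) \<in> measurable (PiM {j} ?P) (?P j)"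
    by (rule measurable_component_singleton) simp
  have ind: "indep_rv M (PiM I N \<Otimes>\<^sub>M PiM I N') (\<lambda>\<omega>. (?X \<omega>, ?Y \<omega>)) (?P j) (\<lambda>\<omega>. (X j \<omega>, Y j \<omega>))"
    using indep_rv_compose[OF ind0 \<phi> \<psi>] by (simp add: restrict_def cong: if_cong)
  have mj: "maxcorr_le M (N j) (X j) (N' j) (Y j) \<rho>"
    using insert.prems(2) by simp
  have upd: "(\<lambda>z. (fst z)(j := snd z)) \<in> measurable (PiM I L \<Otimes>\<^sub>M L j) (PiM (insert j I) L)" for L :: "_ \<Rightarrow> 'z measure"
    using measurable_add_dim[of j I L] by (simp add: case_prod_unfold)
  have sums: "{(\<lambda>\<omega>. u \<omega> + b \<omega>) | u b. u \<in> space_sum I (\<lambda>i. centered_L2 M (L i) (W i)) \<and> b \<in> centered_L2 M (L j) (W j)}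
      \<subseteq> space_sum (insert j I) (\<lambda>i. centered_L2 M (L i) (W i))" for L :: "_ \<Rightarrow> 'z measure" and W
  proof safe
    fix u b assume "u \<in> space_sum I (\<lambda>i. centered_L2 M (L i) (W i))" and b: "b \<in> centered_L2 M (L j) (W j)"
    then obtain w where w: "u = (\<lambda>\<omega>. \<Sum>i\<in>I. w i \<omega>)" "\<And>i. i \<in> I \<Longrightarrow> w i \<in> centered_L2 M (L i) (W i)"
      by (auto simp: space_sum_def)
    have "(\<lambda>\<omega>. u \<omega> + b \<omega>) = (\<lambda>\<omega>. \<Sum>i\<in>insert j I. (w(j := b)) i \<omega>)"
    proof
      fix \<omega>
      have "(\<Sum>i\<in>I. (w(j := b)) i \<omega>) = (\<Sum>i\<in>I. w i \<omega>)"
        using insert.hyps by (intro sum.cong) auto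
      then show "u \<omega> + b \<omega> = (\<Sum>i\<in>insert j I. (w(j := b)) i \<omega>)"
        using insert.hyps by (simp add: w(1))
    qed
    moreover have "\<forall>i\<in>insert j I. (w(j := b)) i \<in> centered_L2 M (L i) (W i)"
      using w(2) b by simp
    ultimately show "(\<lambda>\<omega>. u \<omega> + b \<omega>) \<in> space_sum (insert j I) (\<lambda>i. centered_L2 M (L i) (W i))"
      unfolding space_sum_def by blast
  qed
  show ?case
  proof (rule split_bound_compose[OF split_bound_pair[OF ind \<rho> sb mj space_sum_centered_L2 space_sum_centered_L2]
        upd _ upd _ sums sums])
    show "(\<lambda>i\<in>insert j I. X i \<omega>) = (fst (?X \<omega>, X j \<omega>))(j := snd (?X \<omega>, X j \<omega>))"
      "(\<lambda>i\<in>insert j I. Y i \<omega>) = (fst (?Y \<omega>, Y j \<omega>))(j := snd (?Y \<omega>, Y j \<omega>))" for \<omega>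
      by (auto simp: fun_eq_iff)
  qed
qed

section \<open>From correlation coefficients to norm inequalities\<close>

text \<open>The product form also covers the degenerate case: if a centred norm is 0,
  Cauchy--Schwarz forces the covariance to be 0. Otherwise neither variable is almost surely
  constant and the quotient in \<open>corr\<close> applies.\<close>

lemma covar_eq_corr:
  assumes u: "sqint M u" and v: "sqint M v"
  shows "covar M u v = corr M u v * (nrm M (\<lambda>x. u x - expectation u) * nrm M (\<lambda>x. v x - expectation v))"
proof -
  note c = sqint_center[OF u] sqint_center[OF v]
  have s: "sqrt (covar M w w) = nrm M (\<lambda>x. w x - expectation w)" for w
    by (simp add: covar_def nrm_def power2_eq_square)
  have z: "nrm M (\<lambda>x. w x - expectation w) = 0" if w: "sqint M w" and "AE x in M. w x = c" for w c
  proof -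
    have "expectation w = expectation (\<lambda>_. c)"
      using sqintD[OF w] that(2) by (intro integral_cong_AE) auto
    then show ?thesis
      using that(2) nrm_eq_0_iff[OF sqint_center[OF w]] by (auto simp: prob_space)
  qed
  have le: "\<bar>covar M u v\<bar> \<le> nrm M (\<lambda>x. u x - expectation u) * nrm M (\<lambda>x. v x - expectation v)"
    unfolding covar_def by (rule abs_integral_mult_le_nrm[OF c])
  show ?thesis
  proof (cases "nrm M (\<lambda>x. u x - expectation u) * nrm M (\<lambda>x. v x - expectation v) = 0")
    case True
    from le have "covar M u v = 0" unfolding True by simp
    then show ?thesis unfolding True by simp
  next
    case False
    then have "\<not> (\<exists>c. AE \<omega> in M. u \<omega> = c)" "\<not> (\<exists>c. AE \<omega> in M. v \<omega> = c)"
      using z[OF u] z[OF v] by auto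
    then show ?thesis using False by (simp add: corr_def s)
  qed
qed

text \<open>When a centred norm vanishes, the correlation is 0 and \<open>0 \<le> K\<close> decides;
  otherwise one divides by the positive product of norms.\<close>

lemma corr_leI:
  assumes u: "sqint M u" and v: "sqint M v" and K: "0 \<le> K"
    and le: "covar M u v \<le> K * (nrm M (\<lambda>x. u x - expectation u) * nrm M (\<lambda>x. v x - expectation v))"
  shows "corr M u v \<le> K"
proof (cases "nrm M (\<lambda>x. u x - expectation u) * nrm M (\<lambda>x. v x - expectation v) = 0")
  case True
  then show ?thesis
    using K by (auto simp: corr_def covar_def nrm_def power2_eq_square)
next
  case False
  then have "0 < nrm M (\<lambda>x. u x - expectation u) * nrm M (\<lambda>x. v x - expectation v)"
    by (simp add: less_le)
  with le show ?thesis
    unfolding covar_eq_corr[OF u v] by (simp only: mult_le_cancel_right_pos)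
qed

lemma corr_le_1:
  assumes "sqint M u" "sqint M v"
  shows "corr M u v \<le> 1"
  using integral_mult_le_nrm[OF sqint_center[OF assms(1)] sqint_center[OF assms(2)]]
  by (intro corr_leI assms) (simp_all add: covar_def)

text \<open>The real supremum is an upper bound only for sets bounded above; Cauchy--Schwarz
  provides the bound 1.\<close>

lemma corr_le_Corr:
  assumes "u \<in> A" "v \<in> B" and A: "\<And>u. u \<in> A \<Longrightarrow> sqint M u" and B: "\<And>v. v \<in> B \<Longrightarrow> sqint M v"
  shows "corr M u v \<le> Corr M A B"
  unfolding Corr_def
proof (rule cSup_upper)
  show "bdd_above {corr M u v |u v. u \<in> A \<and> v \<in> B}"
    using corr_le_1 A B by (intro bdd_aboveI[of _ 1]) auto
qed (use assms in auto)

lemma L2_sqint: "Z \<in> measurable M N \<Longrightarrow> u \<in> L2 M N Z \<Longrightarrow> sqint M u"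
  by (auto simp: L2_def sqint_def)

lemma centered_L2_subset_L2: "centered_L2 M N Z \<subseteq> L2 M N Z"
  by (auto simp: L2_def centered_L2_def sqint_def)

lemma maxcorr_le_of_Corr:
  assumes X: "X \<in> measurable M N" and Y: "Y \<in> measurable M N'" and \<rho>: "0 \<le> \<rho>"
    and le: "Corr M (L2 M N X) (L2 M N' Y) \<le> \<rho>"
  shows "maxcorr_le M N X N' Y \<rho>"
proof (rule maxcorr_leI[OF \<rho>])
  fix g h assume gm: "g \<in> borel_measurable N" and hm: "h \<in> borel_measurable N'"
    and g: "sqint M (\<lambda>x. g (X x))" and h: "sqint M (\<lambda>x. h (Y x))"
    and 0: "expectation (\<lambda>x. g (X x)) = 0" "expectation (\<lambda>x. h (Y x)) = 0"
  have "corr M (\<lambda>x. g (X x)) (\<lambda>x. h (Y x)) \<le> Corr M (L2 M N X) (L2 M N' Y)"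
    using gm hm g h by (intro corr_le_Corr L2_sqint[OF X] L2_sqint[OF Y]) (auto simp: L2_def sqint_def)
  with le have "corr M (\<lambda>x. g (X x)) (\<lambda>x. h (Y x)) \<le> \<rho>" by simp
  then have "corr M (\<lambda>x. g (X x)) (\<lambda>x. h (Y x)) * (nrm M (\<lambda>x. g (X x)) * nrm M (\<lambda>x. h (Y x)))
      \<le> \<rho> * (nrm M (\<lambda>x. g (X x)) * nrm M (\<lambda>x. h (Y x)))"
    by (intro mult_right_mono) simp_all
  then show "expectation (\<lambda>x. g (X x) * h (Y x)) \<le> \<rho> * (nrm M (\<lambda>x. g (X x)) * nrm M (\<lambda>x. h (Y x)))"
    using covar_eq_corr[OF g h] by (simp add: covar_def 0)
qed

text \<open>Orthogonality turns the squared norm of \<open>u\<close> into the expectation of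
  \<open>g u\<close>, which the correlation bound estimates by \<open>s\<close> times the product of
  the norms; cancel one norm of \<open>u\<close>. In this way a correlation hypothesis limits the
  first-order share of \<open>g\<close>.\<close>

lemma nrm_le_of_Corr:
  assumes g: "g \<in> A" "sqint M g" "expectation g = 0" and u: "u \<in> B" "expectation u = 0"
    and A: "\<And>u. u \<in> A \<Longrightarrow> sqint M u" and B: "\<And>v. v \<in> B \<Longrightarrow> sqint M v"
    and orth: "expectation (\<lambda>\<omega>. (g \<omega> - u \<omega>) * u \<omega>) = 0"
    and le: "Corr M A B \<le> s" and s: "0 \<le> s"
  shows "nrm M u \<le> s * nrm M g"
proof -
  have uq: "sqint M u" using B u(1) by simp
  have "(nrm M u)\<^sup>2 = expectation (\<lambda>\<omega>. g \<omega> * u \<omega>)"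
    using orth integral_diff_mult[OF g(2) uq uq] by (simp add: nrm_power2) (simp add: power2_eq_square)
  also have "\<dots> = corr M g u * (nrm M g * nrm M u)"
    using covar_eq_corr[OF g(2) uq] by (simp add: covar_def g(3) u(2))
  also have "\<dots> \<le> s * (nrm M g * nrm M u)"
    using corr_le_Corr[OF g(1) u(1) A B] le by (intro mult_right_mono) auto
  finally have "nrm M u * nrm M u \<le> (s * nrm M g) * nrm M u"
    by (simp add: power2_eq_square mult.assoc)
  then show ?thesis
    using s by (cases "nrm M u = 0") (auto simp: mult_le_cancel_right less_le)
qed

end

lemma space_sum_mono: "(\<And>i. i \<in> I \<Longrightarrow> A i \<subseteq> B i) \<Longrightarrow> space_sum I A \<subseteq> space_sum I B"
  unfolding space_sum_def by blast

theorem lemma1p6: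
  fixes M :: "'a measure" and n :: nat and \<rho> \<epsilon> :: real
    and X Y :: "nat \<Rightarrow> 'a \<Rightarrow> real" and f :: "(nat \<Rightarrow> real) \<Rightarrow> real"
  defines "XX \<equiv> (\<lambda>\<omega>. \<lambda>i\<in>{1..n}. X i \<omega>)"
    and "YY \<equiv> (\<lambda>\<omega>. \<lambda>i\<in>{1..n}. Y i \<omega>)"
  assumes "prob_space M"
    and "n \<ge> 1" and "0 \<le> \<rho>" and "\<rho> \<le> 1"
    and "prob_space.indep_vars M (\<lambda>_. borel \<Otimes>\<^sub>M borel) (\<lambda>i \<omega>. (X i \<omega>, Y i \<omega>)) {1..n}"
    and "\<And>i. i \<in> {1..n} \<Longrightarrow> Corr M (L2 M borel (X i)) (L2 M borel (Y i)) \<le> \<rho>"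
    and "f \<in> borel_measurable (Pi\<^sub>M {1..n} (\<lambda>_. borel))"
    and "integrable M (\<lambda>\<omega>. (f (XX \<omega>))\<^sup>2)"
    and "integrable M (\<lambda>\<omega>. (f (YY \<omega>))\<^sup>2)"
    and "\<epsilon> > 0"
    and "Corr M (L2 M borel (\<lambda>\<omega>. f (XX \<omega>)))
           (space_sum {1..n} (\<lambda>i. L2 M borel (X i))) \<le> sqrt (1 - \<epsilon>)"
    and "Corr M (L2 M borel (\<lambda>\<omega>. f (YY \<omega>)))
           (space_sum {1..n} (\<lambda>i. L2 M borel (Y i))) \<le> sqrt (1 - \<epsilon>)"
  shows "Corr M (L2 M borel (\<lambda>\<omega>. f (XX \<omega>))) (L2 M borel (\<lambda>\<omega>. f (YY \<omega>)))
           \<le> (1 - \<epsilon>) * \<rho> + \<epsilon> * \<rho>\<^sup>2"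
proof -
  interpret prob_space M by fact
  let ?I = "{1..n}"
  note ind = assms(7) and \<rho> = assms(5,6) and fm [measurable] = assms(9) and \<epsilon> = assms(12)
  have XYm: "(\<lambda>\<omega>. (X i \<omega>, Y i \<omega>)) \<in> measurable M (borel \<Otimes>\<^sub>M borel)" if "i \<in> ?I" for i
    using ind that by (auto simp: indep_vars_def)
  have Xm: "X i \<in> borel_measurable M" and Ym: "Y i \<in> borel_measurable M" if "i \<in> ?I" for i
    using measurable_compose[OF XYm[OF that] measurable_fst] measurable_compose[OF XYm[OF that] measurable_snd]
    by simp_all
  have XXm: "XX \<in> measurable M (PiM ?I (\<lambda>_. borel))" and YYm: "YY \<in> measurable M (PiM ?I (\<lambda>_. borel))"
    unfolding XX_def YY_def by (auto intro!: measurable_restrict Xm Ym)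
  let ?LX = "L2 M borel (\<lambda>\<omega>. f (XX \<omega>))" and ?LY = "L2 M borel (\<lambda>\<omega>. f (YY \<omega>))"
  let ?SX = "space_sum ?I (\<lambda>i. L2 M borel (X i))" and ?SY = "space_sum ?I (\<lambda>i. L2 M borel (Y i))"
  have LX: "sqint M u" if "u \<in> ?LX" for u
    using L2_sqint[OF measurable_compose[OF XXm fm] that] .
  have LY: "sqint M u" if "u \<in> ?LY" for u
    using L2_sqint[OF measurable_compose[OF YYm fm] that] .
  have SX: "sqint M u" if "u \<in> ?SX" for u
    using that by (auto simp: space_sum_def intro!: sqint_sum L2_sqint[OF Xm])
  have SY: "sqint M u" if "u \<in> ?SY" for u
    using that by (auto simp: space_sum_def intro!: sqint_sum L2_sqint[OF Ym])
  have zero_L2: "(\<lambda>_. 0) \<in> L2 M borel Z" for Z :: "'a \<Rightarrow> real"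
    by (auto simp: L2_def intro!: exI[of _ "\<lambda>_. 0"])
  have zero_sum: "(\<lambda>_. 0) \<in> ?SX"
    unfolding space_sum_def using zero_L2 by (auto intro!: exI[of _ "\<lambda>_ _. 0"])
  \<comment> \<open>The zero function lies in both spaces, so the supremum is nonnegative and so is
    \<open>sqrt (1 - \<epsilon>)\<close>. As \<open>sqrt\<close> is negative at negative arguments,
    \<open>\<epsilon> \<le> 1\<close> follows.\<close>
  have "0 = corr M (\<lambda>_. 0) (\<lambda>_. 0)" by (simp add: corr_def)
  also have "\<dots> \<le> Corr M ?LX ?SX"
    by (intro corr_le_Corr zero_L2 zero_sum LX SX)
  also note assms(13)
  finally have \<epsilon>1: "\<epsilon> \<le> 1" by simp
  have sb: "split_bound M (PiM ?I (\<lambda>_. borel)) XX (space_sum ?I (\<lambda>i. centered_L2 M borel (X i)))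
    (PiM ?I (\<lambda>_. borel)) YY (space_sum ?I (\<lambda>i. centered_L2 M borel (Y i))) \<rho>"
    unfolding XX_def YY_def
    using ind \<rho> assms(8) Xm Ym by (intro split_bound_PiM maxcorr_le_of_Corr) auto
  show ?thesis
    unfolding Corr_def[of M ?LX ?LY]
  proof (rule cSup_least)
    show "{corr M u v |u v. u \<in> ?LX \<and> v \<in> ?LY} \<noteq> {}"
      using zero_L2 by blast
    fix c assume "c \<in> {corr M u v |u v. u \<in> ?LX \<and> v \<in> ?LY}"
    then obtain u v where c: "c = corr M u v" and u: "u \<in> ?LX" and v: "v \<in> ?LY" by blast
    define u0 where "u0 \<omega> = u \<omega> - expectation u" for \<omega>
    define v0 where "v0 \<omega> = v \<omega> - expectation v" for \<omega>
    have sq0: "sqint M u0" "sqint M v0"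
      using sqint_center[OF LX[OF u]] sqint_center[OF LY[OF v]] by (simp_all add: u0_def[abs_def] v0_def[abs_def])
    have e0: "expectation u0 = 0" "expectation v0 = 0"
      using integrable_sqint[OF LX[OF u]] integrable_sqint[OF LY[OF v]]
      by (simp_all add: u0_def[abs_def] v0_def[abs_def] prob_space)
    obtain \<phi> where [measurable]: "\<phi> \<in> borel_measurable borel" and \<phi>: "u = (\<lambda>\<omega>. \<phi> (f (XX \<omega>)))"
      using u by (auto simp: L2_def)
    obtain \<psi> where [measurable]: "\<psi> \<in> borel_measurable borel" and \<psi>: "v = (\<lambda>\<omega>. \<psi> (f (YY \<omega>)))"
      using v by (auto simp: L2_def)
    have u0_eq: "u0 = (\<lambda>\<omega>. (\<lambda>z. \<phi> z - expectation u) (f (XX \<omega>)))"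
      and v0_eq: "v0 = (\<lambda>\<omega>. (\<lambda>z. \<psi> z - expectation v) (f (YY \<omega>)))"
      by (simp_all add: u0_def v0_def \<phi> \<psi> fun_eq_iff)
    \<comment> \<open>Subtracting the mean stays within the functions of
      \<open>f (XX \<omega>)\<close>, so the correlation hypothesis applies to the centred
      function.\<close>
    have u0L: "u0 \<in> ?LX"
      unfolding L2_def using u0_eq sq0(1)
      by (auto simp: sqint_def intro!: exI[of _ "\<lambda>z. \<phi> z - expectation u"])
    have v0L: "v0 \<in> ?LY"
      unfolding L2_def using v0_eq sq0(2)
      by (auto simp: sqint_def intro!: exI[of _ "\<lambda>z. \<psi> z - expectation v"])
    have m: "(\<lambda>x. \<phi> (f x) - expectation u) \<in> borel_measurable (PiM ?I (\<lambda>_. borel))"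
      "(\<lambda>x. \<psi> (f x) - expectation v) \<in> borel_measurable (PiM ?I (\<lambda>_. borel))"
      by measurable
    have "u0 \<in> centered_L2 M (PiM ?I (\<lambda>_. borel)) XX"
      using centered_L2I[OF m(1), of M XX] sq0(1) e0(1) unfolding u0_eq by blast
    moreover have "v0 \<in> centered_L2 M (PiM ?I (\<lambda>_. borel)) YY"
      using centered_L2I[OF m(2), of M YY] sq0(2) e0(2) unfolding v0_eq by blast
    ultimately obtain p q where p: "p \<in> space_sum ?I (\<lambda>i. centered_L2 M borel (X i))"
      and q: "q \<in> space_sum ?I (\<lambda>i. centered_L2 M borel (Y i))"
      and po: "expectation (\<lambda>\<omega>. (u0 \<omega> - p \<omega>) * p \<omega>) = 0" and qo: "expectation (\<lambda>\<omega>. (v0 \<omega> - q \<omega>) * q \<omega>) = 0"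
      and le: "expectation (\<lambda>\<omega>. u0 \<omega> * v0 \<omega>) \<le> \<rho> * (nrm M p * nrm M q) +
        \<rho>\<^sup>2 * (nrm M (\<lambda>\<omega>. u0 \<omega> - p \<omega>) * nrm M (\<lambda>\<omega>. v0 \<omega> - q \<omega>))"
      using sb[unfolded split_bound_def, rule_format] by blast
    have pS: "p \<in> ?SX" and qS: "q \<in> ?SY"
      using subsetD[OF space_sum_mono[OF centered_L2_subset_L2] p]
        subsetD[OF space_sum_mono[OF centered_L2_subset_L2] q] .
    have pe: "expectation p = 0" and qe: "expectation q = 0"
      by (rule centered_L2_integral, rule subsetD[OF space_sum_centered_L2], rule p q)+
    define A B where "A = nrm M u0" and "B = nrm M v0"
    have s: "0 \<le> sqrt (1 - \<epsilon>)" using \<epsilon>1 by simp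
    have pA: "nrm M p \<le> sqrt (1 - \<epsilon>) * A"
      unfolding A_def by (rule nrm_le_of_Corr[OF u0L sq0(1) e0(1) pS pe LX SX po assms(13) s])
    have qB: "nrm M q \<le> sqrt (1 - \<epsilon>) * B"
      unfolding B_def by (rule nrm_le_of_Corr[OF v0L sq0(2) e0(2) qS qe LY SY qo assms(14) s])
    have "nrm M p * nrm M q \<le> (sqrt (1 - \<epsilon>) * A) * (sqrt (1 - \<epsilon>) * B)"
      using pA qB s by (intro mult_mono) (simp_all add: A_def)
    also have "\<dots> = (1 - \<epsilon>) * (A * B)"
      using \<epsilon>1 by (simp add: algebra_simps)
    finally have pq: "nrm M p * nrm M q \<le> (1 - \<epsilon>) * (A * B)" .
    have CS: "nrm M p * nrm M q + nrm M (\<lambda>\<omega>. u0 \<omega> - p \<omega>) * nrm M (\<lambda>\<omega>. v0 \<omega> - q \<omega>) \<le> A * B"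
      using nrm_split[OF sq0(1) SX[OF pS] po] nrm_split[OF sq0(2) SY[OF qS] qo]
      unfolding A_def B_def by (intro Cauchy_Schwarz_2) auto
    note le
    \<comment> \<open>Regrouping leaves the nonnegative weights \<open>\<rho> - \<rho>^2\<close> and
      \<open>\<rho>^2\<close>: the first multiplies the product limited by
      \<open>1 - \<epsilon>\<close>, the second the sum controlled by Cauchy--Schwarz.\<close>
    also have "\<rho> * (nrm M p * nrm M q) + \<rho>\<^sup>2 * (nrm M (\<lambda>\<omega>. u0 \<omega> - p \<omega>) * nrm M (\<lambda>\<omega>. v0 \<omega> - q \<omega>))
      = (\<rho> - \<rho>\<^sup>2) * (nrm M p * nrm M q) +
        \<rho>\<^sup>2 * (nrm M p * nrm M q + nrm M (\<lambda>\<omega>. u0 \<omega> - p \<omega>) * nrm M (\<lambda>\<omega>. v0 \<omega> - q \<omega>))"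
      by (simp add: algebra_simps)
    also have "\<dots> \<le> (\<rho> - \<rho>\<^sup>2) * ((1 - \<epsilon>) * (A * B)) + \<rho>\<^sup>2 * (A * B)"
      using pq CS \<rho> by (intro add_mono mult_left_mono) (auto simp: power2_eq_square mult_left_le_one_le)
    also have "\<dots> = ((1 - \<epsilon>) * \<rho> + \<epsilon> * \<rho>\<^sup>2) * (A * B)"
      by (simp add: algebra_simps)
    finally have "covar M u v \<le> ((1 - \<epsilon>) * \<rho> + \<epsilon> * \<rho>\<^sup>2) *
        (nrm M (\<lambda>x. u x - expectation u) * nrm M (\<lambda>x. v x - expectation v))"
      by (simp add: covar_def u0_def[abs_def] v0_def[abs_def] A_def B_def)
    then show "c \<le> (1 - \<epsilon>) * \<rho> + \<epsilon> * \<rho>\<^sup>2"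
      unfolding c using \<epsilon> \<epsilon>1 \<rho> by (intro corr_leI LX[OF u] LY[OF v]) auto
  qed
qed

end
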